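(* In the setting and under hypotheses (i)-(vi) of the context, for every $x\in E$ the limit process $\{X(t,x)\}_{t\ge0}$ described in the context is the unique mild solution of the SPDE $$dX(t,x)=(AX(t,x)+F(X(t,x)))dt+\sqrt C\,dW(t),\ t>0,\qquad X(0,x)=x,$$ in $C_p([0,T],\mathcal X)\cap C_p((0,T],E)$, for every $p\ge1$ and $T>0$.
   Context: Setting. $\mathcal X$ is a real separable Hilbert space (inner product $\langle\cdot,\cdot\rangle$, norm $\|\cdot\|$); $(\Omega,\mathcal F,\{\mathcal F_t\}_{t\ge0},\mathbb P)$ is a filtered (normal) probability space; $\{W(t)\}_{t\ge0}$ is an $\mathcal X$-valued cylindrical Wiener process on it; $A:\mathrm{Dom}(A)\subseteq\mathcal X\to\mathcal X$ generates a strongly continuous semigroup $e^{tA}$; $C$ is a bounded, self-adjoint, non-negative linear operator on $\mathcal X$; $F:\mathrm{Dom}(F)\subseteq\mathcal X\to\mathcal X$ is a possibly nonlinear map; $W_A(t):=\int_0^te^{(t-s)A}\sqrt C\,dW(s)$. All processes are adapted. A map $f:\mathrm{Dom}(f)\subseteq K\to K$ on a Banach space $K$ is dissipative if $\|x-y-\alpha(f(x)-f(y))\|_K\ge\|x-y\|_K$ for all $\alpha>0$, $x,y\in\mathrm{Dom}(f)$. The part $A_E$ of $A$ in $E\subseteq\mathcal X$ is the restriction of $A$ to $\{x\in\mathrm{Dom}(A)\cap E: Ax\in E\}$; it is also denoted by $A$. Analytic semigroups are those generated by sectorial operators (not necessarily densely defined). Hypotheses. (i) There is a Banach space $E\subseteq\mathrm{Dom}(F)$,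 Borel measurable, densely and continuously embedded in $\mathcal X$, with $F(E)\subseteq E$. (ii) $A$ generates a strongly continuous and analytic semigroup $e^{tA}$ on $\mathcal X$, and $A_E$ generates an analytic semigroup on $E$. (iii) There is $\zeta\in\mathbb R$ such that $A+F-\zeta I$ is dissipative in $\mathcal X$ and $A_E+F_{|E}-\zeta I$ is dissipative in $E$. (iv) $\{W_A(t)\}_{t\ge0}$ is an $E$-valued continuous process and $\int_0^T\mathrm{Tr}[e^{sA}Ce^{sA^*}]ds<+\infty$ for all $T>0$. (v) There are $M>0$, $m\in\mathbb N$ with $\|F(x)\|_E\le M(1+\|x\|_E^m)$ for $x\in E$. (vi) $F_{|E}:E\to E$ is Lipschitz continuous on bounded subsets of $E$. Definitions. For an interval $I$, a Banach space $K$ and $p\ge1$, $C_p(I,K)$ is the space of $K$-valued processes $\{Y(t)\}_{t\in I}$ with continuous paths, with norm $\|Y\|_{C_p(I,K)}^p=\mathbb E[\sup_{t\in\overline I}\|Y(t)\|_K^p]$. For $x\in E$, a mild solution of the SPDE is an $E$-valued process with $X(t,x)=e^{tA}x+\int_0^te^{(t-s)A}F(X(s,x))ds+W_A(t)$, $\mathbb P$-a.s., for every $t\ge0$; it is unique if any other process satisfying this is a version of it. For large $n\in\mathbb N$ (so that $n$ is in the resolvent sets of $A$ and $A_E$; $R(n,A)=(nI-A)^{-1}$) and $x\in E$, let $X_n(\cdot,x)$ be the unique process in $C_p([0,T],E)$ (for all $p\ge 1$, $T>0$) with $X_n(t,x)=e^{tA}nR(n,A)x+\int_0^te^{(t-s)A}F(X_n(s,x))ds+W_A(t)$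 $\mathbb P$-a.s. The process $X(\cdot,x)$ is the limit of $X_n(\cdot,x)$: it is the process belonging to $C_p((0,T],E)\cap C_p([0,T],\mathcal X)$ for all $p\ge1$, $T>0$ with $\lim_n\|X_n(\cdot,x)-X(\cdot,x)\|_{C([0,T],\mathcal X)}=0$ for all $T>0$ and $\lim_n\|X_n(\cdot,x)-X(\cdot,x)\|_{C([\epsilon,T],E)}=0$ for all $0<\epsilon\le T$, $\mathbb P$-a.s. (these limits exist under the hypotheses). *)

theory Defs
  imports "HOL-Probability.Probability"
begin

section \<open>Unbounded operators and semigroups\<close>

definition linear_operator :: "'a::real_vector set \<Rightarrow> ('a \<Rightarrow> 'a) \<Rightarrow> bool" where
  "linear_operator D A \<longleftrightarrow> subspace D \<and>
     (\<forall>x\<in>D. \<forall>y\<in>D. A (x + y) = A x + A y) \<and> (\<forall>c. \<forall>x\<in>D. A (c *\<^sub>R x) = c *\<^sub>R A x)"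

definition C0_semigroup :: "(real \<Rightarrow> 'a::real_normed_vector \<Rightarrow> 'a) \<Rightarrow> bool" where
  "C0_semigroup S \<longleftrightarrow>
     (\<forall>t\<ge>0. bounded_linear (S t)) \<and> S 0 = id \<and>
     (\<forall>s\<ge>0. \<forall>t\<ge>0. S (s + t) = S s \<circ> S t) \<and>
     (\<forall>x. ((\<lambda>t. S t x) \<longlongrightarrow> x) (at_right 0))"

definition generates_C0_semigroup ::
    "'a::real_normed_vector set \<Rightarrow> ('a \<Rightarrow> 'a) \<Rightarrow> (real \<Rightarrow> 'a \<Rightarrow> 'a) \<Rightarrow> bool" where
  "generates_C0_semigroup D A S \<longleftrightarrow> C0_semigroup S \<and>
     D = {x. \<exists>y. ((\<lambda>h. (1 / h) *\<^sub>R (S h x - x)) \<longlongrightarrow> y) (at_right 0)} \<and>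
     (\<forall>x\<in>D. ((\<lambda>h. (1 / h) *\<^sub>R (S h x - x)) \<longlongrightarrow> A x) (at_right 0))"

text \<open>Spectral notions of an operator on a real space refer to its complexification. The pair
  \<open>(x, y)\<close> stands for \<open>x + i y\<close>, and \<open>cx_shift A z\<close> is \<open>z I - A\<close> on the complexification.
  The norm of the product type is equivalent to the usual complexification norms, so that
  boundedness, and the existence of the constant \<open>M\<close> in \<open>sectorial\<close>, do not depend on the choice.\<close>

definition cx_shift :: "('a::real_normed_vector \<Rightarrow> 'a) \<Rightarrow> complex \<Rightarrow> 'a \<times> 'a \<Rightarrow> 'a \<times> 'a" where
  "cx_shift A z = (\<lambda>(x, y). (Re z *\<^sub>R x - Im z *\<^sub>R y - A x, Im z *\<^sub>R x + Re z *\<^sub>R y - A y))"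

definition cx_resolvent ::
    "'a::real_normed_vector set \<Rightarrow> ('a \<Rightarrow> 'a) \<Rightarrow> complex \<Rightarrow> 'a \<times> 'a \<Rightarrow> 'a \<times> 'a" where
  "cx_resolvent D A z = inv_into (D \<times> D) (cx_shift A z)"

definition resolvent_set :: "'a::real_normed_vector set \<Rightarrow> ('a \<Rightarrow> 'a) \<Rightarrow> complex set" where
  "resolvent_set D A = {z. bij_betw (cx_shift A z) (D \<times> D) UNIV \<and> bounded_linear (cx_resolvent D A z)}"

definition resolvent :: "'a::real_normed_vector set \<Rightarrow> ('a \<Rightarrow> 'a) \<Rightarrow> real \<Rightarrow> 'a \<Rightarrow> 'a" where
  "resolvent D A r = inv_into D (\<lambda>z. r *\<^sub>R z - A z)"

text \<open>The domain of a sectorial operator need not be dense.\<close>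

definition sectorial :: "'a::real_normed_vector set \<Rightarrow> ('a \<Rightarrow> 'a) \<Rightarrow> bool" where
  "sectorial D A \<longleftrightarrow> linear_operator D A \<and>
     (\<exists>(\<omega>::real) \<theta> M. pi / 2 < \<theta> \<and> \<theta> < pi \<and> M > 0 \<and>
        (\<forall>z. z \<noteq> of_real \<omega> \<and> \<bar>Arg (z - of_real \<omega>)\<bar> < \<theta> \<longrightarrow>
           z \<in> resolvent_set D A \<and>
           (\<forall>u. norm (cx_resolvent D A z u) \<le> M / cmod (z - of_real \<omega>) * norm u)))"

text \<open>An analytic semigroup is by definition one whose generator is sectorial.\<close>

abbreviation generates_analytic_semigroup :: "'a::real_normed_vector set \<Rightarrow> ('a \<Rightarrow> 'a) \<Rightarrow> bool" where
  "generates_analytic_semigroup \<equiv> sectorial"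

definition dissipative_on :: "'a::real_normed_vector set \<Rightarrow> ('a \<Rightarrow> 'a) \<Rightarrow> bool" where
  "dissipative_on D f \<longleftrightarrow>
     (\<forall>\<alpha>>0. \<forall>x\<in>D. \<forall>y\<in>D. norm (x - y - \<alpha> *\<^sub>R (f x - f y)) \<ge> norm (x - y))"

text \<open>A subspace \<open>E\<close> carrying its own Banach norm is a type \<open>'e\<close> together with
  an injection \<open>j\<close>; \<open>E\<close> itself is \<open>range j\<close>. The following are the domain of the part of \<open>A\<close>
  in \<open>E\<close>, and the map induced in \<open>E\<close> (meaningful where \<open>f (j e)\<close> lies in \<open>range j\<close>).\<close>

definition part_dom :: "('e \<Rightarrow> 'x) \<Rightarrow> 'x set \<Rightarrow> ('x \<Rightarrow> 'x) \<Rightarrow> 'e set" where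
  "part_dom j D A = {e. j e \<in> D \<and> A (j e) \<in> range j}"

definition part_map :: "('e \<Rightarrow> 'x) \<Rightarrow> ('x \<Rightarrow> 'x) \<Rightarrow> 'e \<Rightarrow> 'e" where
  "part_map j f e = inv j (f (j e))"

section \<open>Bounded operators on a Hilbert space\<close>

definition nonneg_selfadjoint :: "('x::real_inner \<Rightarrow> 'x) \<Rightarrow> bool" where
  "nonneg_selfadjoint C \<longleftrightarrow> bounded_linear C \<and>
     (\<forall>x y. inner (C x) y = inner x (C y)) \<and> (\<forall>x. inner (C x) x \<ge> 0)"

definition sqrt_op :: "('x::real_inner \<Rightarrow> 'x) \<Rightarrow> 'x \<Rightarrow> 'x" where
  "sqrt_op C = (THE R. nonneg_selfadjoint R \<and> R \<circ> R = C)"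

definition orthonormal_basis :: "'x::real_inner set \<Rightarrow> bool" where
  "orthonormal_basis B \<longleftrightarrow>
     (\<forall>b\<in>B. norm b = 1) \<and> (\<forall>b\<in>B. \<forall>c\<in>B. b \<noteq> c \<longrightarrow> inner b c = 0) \<and> closure (span B) = UNIV"

definition some_basis :: "'x::real_inner set" where
  "some_basis = (SOME B. orthonormal_basis B)"

text \<open>The trace (of a nonnegative self-adjoint operator) and the Hilbert-Schmidt norm
  do not depend on the choice of the basis.\<close>

definition op_trace :: "('x::real_inner \<Rightarrow> 'x) \<Rightarrow> ennreal" where
  "op_trace T = (\<Sum>\<^sub>\<infinity>b\<in>some_basis. ennreal (inner (T b) b))"

definition hs_norm_sq :: "('x::real_inner \<Rightarrow> 'x) \<Rightarrow> ennreal" where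
  "hs_norm_sq T = (\<Sum>\<^sub>\<infinity>b\<in>some_basis. ennreal ((norm (T b))\<^sup>2))"

section \<open>Stochastic processes\<close>

definition normal_filtered_prob_space :: "'w measure \<Rightarrow> (real \<Rightarrow> 'w measure) \<Rightarrow> bool" where
  "normal_filtered_prob_space P Fil \<longleftrightarrow> prob_space P \<and> complete_measure P \<and>
     (\<forall>t\<ge>0. subalgebra P (Fil t)) \<and>
     (\<forall>s\<ge>0. \<forall>t\<ge>s. sets (Fil s) \<subseteq> sets (Fil t)) \<and>
     null_sets P \<subseteq> sets (Fil 0) \<and>
     (\<forall>t\<ge>0. sets (Fil t) = (\<Inter>s\<in>{t<..}. sets (Fil s)))"

text \<open>\<open>W t h\<close> stands for the formal inner product of \<open>W(t)\<close> with \<open>h\<close>; a cylindrical Wiener process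
  does not take values in the Hilbert space.\<close>

definition cylindrical_Wiener ::
    "'w measure \<Rightarrow> (real \<Rightarrow> 'w measure) \<Rightarrow> (real \<Rightarrow> 'x::real_inner \<Rightarrow> 'w \<Rightarrow> real) \<Rightarrow> bool" where
  "cylindrical_Wiener P Fil W \<longleftrightarrow>
     (\<forall>h. AE \<omega> in P. W 0 h \<omega> = 0) \<and>
     (\<forall>h. AE \<omega> in P. continuous_on {0..} (\<lambda>t. W t h \<omega>)) \<and>
     (\<forall>t\<ge>0. \<forall>a b h k. AE \<omega> in P. W t (a *\<^sub>R h + b *\<^sub>R k) \<omega> = a * W t h \<omega> + b * W t k \<omega>) \<and>
     (\<forall>t\<ge>0. \<forall>h. W t h \<in> borel_measurable (Fil t)) \<and>
     (\<forall>s\<ge>0. \<forall>t>s. \<forall>h. h \<noteq> 0 \<longrightarrow>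
        distributed P lborel (\<lambda>\<omega>. W t h \<omega> - W s h \<omega>) (normal_density 0 (sqrt (t - s) * norm h))) \<and>
     (\<forall>s\<ge>0. \<forall>t>s. \<forall>h.
        prob_space.indep_set P (sets (Fil s))
          {(\<lambda>\<omega>. W t h \<omega> - W s h \<omega>) -` B \<inter> space P | B. B \<in> sets borel})"

text \<open>The list entry \<open>(r, s, h, a)\<close> stands for the operator-valued step function equal to the
  rank-one operator \<open>x \<mapsto> \<langle>h, x\<rangle> a\<close> on \<open>(r, s]\<close> and to zero elsewhere. Lists thus describe all
  step functions whose values are finite-rank operators.\<close>

type_synonym 'x elementary = "(real \<times> real \<times> 'x \<times> 'x) list"

definition elementary_on :: "real \<Rightarrow> 'x elementary \<Rightarrow> bool" where
  "elementary_on t \<phi> \<longleftrightarrow> (\<forall>(r, s, h, a)\<in>set \<phi>. 0 \<le> r \<and> r \<le> s \<and> s \<le> t)"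

definition elementary_op :: "'x::real_inner elementary \<Rightarrow> real \<Rightarrow> 'x \<Rightarrow> 'x" where
  "elementary_op \<phi> u x = (\<Sum>(r, s, h, a)\<leftarrow>\<phi>. if r < u \<and> u \<le> s then inner h x *\<^sub>R a else 0)"

definition elementary_integral ::
    "(real \<Rightarrow> 'x::real_inner \<Rightarrow> 'w \<Rightarrow> real) \<Rightarrow> 'x elementary \<Rightarrow> 'w \<Rightarrow> 'x" where
  "elementary_integral W \<phi> \<omega> = (\<Sum>(r, s, h, a)\<leftarrow>\<phi>. (W s h \<omega> - W r h \<omega>) *\<^sub>R a)"

text \<open>\<open>has_stochastic_integral P W t \<Phi> I\<close> means that \<open>I\<close> is (a version of) the Ito integral over
  \<open>[0, t]\<close> of the deterministic operator-valued function \<open>\<Phi>\<close>: the mean-square limit of the integrals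
  of step functions converging to \<open>\<Phi>\<close> in \<open>L\<^sup>2\<close> with respect to the Hilbert-Schmidt norm.\<close>

definition has_stochastic_integral ::
    "'w measure \<Rightarrow> (real \<Rightarrow> 'x::real_inner \<Rightarrow> 'w \<Rightarrow> real) \<Rightarrow> real \<Rightarrow> (real \<Rightarrow> 'x \<Rightarrow> 'x) \<Rightarrow> ('w \<Rightarrow> 'x) \<Rightarrow> bool" where
  "has_stochastic_integral P W t \<Phi> I \<longleftrightarrow> I \<in> borel_measurable P \<and>
     (\<exists>\<phi>. (\<forall>n. elementary_on t (\<phi> n)) \<and>
        (\<lambda>n. \<integral>\<^sup>+u\<in>{0..t}. hs_norm_sq (\<lambda>x. \<Phi> u x - elementary_op (\<phi> n) u x) \<partial>lborel) \<longlonglongrightarrow> 0 \<and>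
        (\<lambda>n. \<integral>\<^sup>+\<omega>. ennreal ((norm (I \<omega> - elementary_integral W (\<phi> n) \<omega>))\<^sup>2) \<partial>P) \<longlonglongrightarrow> 0)"

definition adapted_on ::
    "(real \<Rightarrow> 'w measure) \<Rightarrow> real set \<Rightarrow> (real \<Rightarrow> 'w \<Rightarrow> 'k::topological_space) \<Rightarrow> bool" where
  "adapted_on Fil J Y \<longleftrightarrow> (\<forall>t\<in>J. Y t \<in> borel_measurable (Fil t))"

text \<open>The space \<open>C\<^sub>p(J, K)\<close>. As usual, path continuity is required almost surely; the supremum
  in the norm runs over the closure of the interval \<open>J\<close>.\<close>

definition Cp_process ::
    "'w measure \<Rightarrow> (real \<Rightarrow> 'w measure) \<Rightarrow> real \<Rightarrow> real set \<Rightarrow> (real \<Rightarrow> 'w \<Rightarrow> 'k::real_normed_vector) \<Rightarrow> bool" where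
  "Cp_process P Fil p J Y \<longleftrightarrow> adapted_on Fil J Y \<and>
     (AE \<omega> in P. continuous_on J (\<lambda>t. Y t \<omega>)) \<and>
     (\<integral>\<^sup>+\<omega>. (SUP t\<in>closure J. ennreal (norm (Y t \<omega>) powr p)) \<partial>P) < \<infinity>"

text \<open>\<open>Y\<close> is an \<open>E\<close>-valued adapted process which satisfies, for every \<open>t \<in> J\<close>, almost surely,
  \<open>Y(t) = e\<^sup>t\<^sup>A y\<^sub>0 + \<integral>\<^sub>0\<^sup>t e\<^sup>(\<^sup>t\<^sup>-\<^sup>s\<^sup>)\<^sup>A F(Y(s)) ds + W\<^sub>A(t)\<close>, with a Bochner integral in the Hilbert space.\<close>

definition mild_equation ::
    "'w measure \<Rightarrow> (real \<Rightarrow> 'w measure) \<Rightarrow> ('e::banach \<Rightarrow> 'x::{banach, second_countable_topology}) \<Rightarrow>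
     (real \<Rightarrow> 'x \<Rightarrow> 'x) \<Rightarrow> ('x \<Rightarrow> 'x) \<Rightarrow> (real \<Rightarrow> 'w \<Rightarrow> 'e) \<Rightarrow> real set \<Rightarrow> 'x \<Rightarrow> (real \<Rightarrow> 'w \<Rightarrow> 'e) \<Rightarrow> bool" where
  "mild_equation P Fil j S F WA J y0 Y \<longleftrightarrow> adapted_on Fil J Y \<and>
     (\<forall>t\<in>J. AE \<omega> in P.
        set_integrable lborel {0..t} (\<lambda>s. S (t - s) (F (j (Y s \<omega>)))) \<and>
        j (Y t \<omega>) = S t y0 + (LINT s:{0..t}|lborel. S (t - s) (F (j (Y s \<omega>)))) + j (WA t \<omega>))"

end

theory Submission
  imports Defs
begin

text \<open>Existence: the integral over \<open>[0, r]\<close> in the equation of \<open>X\<^sub>n\<close> can be eliminated by restarting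
  at \<open>r\<close>, which leaves \<open>X\<^sub>n(t) = S(t - r) (X\<^sub>n(r) - W\<^sub>A(r)) + \<integral>\<^sub>r\<^sup>t S(t - s) F(X\<^sub>n(s)) ds + W\<^sub>A(t)\<close>. Here
  \<open>n \<rightarrow> \<infinity>\<close> is harmless by uniform convergence in \<open>E\<close> on \<open>[r, t]\<close>, and \<open>r \<rightarrow> 0\<close> is harmless since \<open>X\<close>
  is bounded in \<open>E\<close> on \<open>(0, T]\<close> and continuous in the Hilbert space at \<open>0\<close>.

  Uniqueness: comparing dissipativity at \<open>h z\<close> and \<open>0\<close> for small \<open>h\<close>, where \<open>F\<close> is Lipschitz, shows that
  \<open>A\<^sub>E\<close> itself is quasi-dissipative. The difference \<open>d\<close> of two solutions is the convolution of \<open>S\<close> with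
  some \<open>g\<close> satisfying \<open>\<parallel>g\<parallel> \<le> L \<parallel>d\<parallel>\<close> in \<open>E\<close>. The regularization \<open>u = R(\<mu>, A\<^sub>E) d\<close> is a strict solution of
  \<open>u' = A\<^sub>E u + R(\<mu>, A\<^sub>E) g\<close> in \<open>E\<close>, so quasi-dissipativity at a maximum of \<open>exp(-\<kappa> t) \<parallel>u(t)\<parallel>\<close> bounds \<open>u\<close>.
  Multiplying by \<open>\<mu> \<rightarrow> \<infinity>\<close> gives a bound for \<open>d\<close>, which for large \<open>\<kappa>\<close> is a contraction. The semigroup
  on \<open>E\<close> never appears.\<close>

section \<open>Strongly continuous semigroups and convolutions\<close>

lemma C0_semigroup_bounded_linear: "C0_semigroup S \<Longrightarrow> 0 \<le> t \<Longrightarrow> bounded_linear (S t)"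
  by (simp add: C0_semigroup_def)

lemma C0_semigroup_0: "C0_semigroup S \<Longrightarrow> S 0 x = x"
  by (simp add: C0_semigroup_def)

lemma C0_semigroup_add: "C0_semigroup S \<Longrightarrow> 0 \<le> s \<Longrightarrow> 0 \<le> t \<Longrightarrow> S (s + t) x = S s (S t x)"
  by (simp add: C0_semigroup_def)

text \<open>Uniform boundedness by Baire category: each orbit is bounded just after time 0, so the
  closed sets \<open>G k\<close> cover the space and one of them contains a ball.\<close>

lemma C0_semigroup_bounded_near_0:
  fixes S :: "real \<Rightarrow> 'a::banach \<Rightarrow> 'a"
  assumes S: "C0_semigroup S"
  obtains \<delta> N where "0 < \<delta>" "0 \<le> N" "\<And>t x. 0 \<le> t \<Longrightarrow> t \<le> \<delta> \<Longrightarrow> norm (S t x) \<le> N * norm x"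
proof -
  define G where "G k = (\<Inter>t\<in>{0<..1 / Suc k}. {x. norm (S t x) \<le> real k})" for k :: nat
  have bl: "bounded_linear (S t)" if "0 \<le> t" for t
    using S that by (rule C0_semigroup_bounded_linear)
  have closed_G: "closed (G k)" for k
    unfolding G_def
    by (intro closed_INT ballI closed_Collect_le continuous_intros bounded_linear.continuous_on[OF bl]) auto
  have "x \<in> \<Union>(range G)" for x
  proof -
    have "((\<lambda>t. norm (S t x)) \<longlongrightarrow> norm x) (at_right 0)"
      using S by (intro tendsto_norm) (simp add: C0_semigroup_def)
    then have "\<forall>\<^sub>F t in at_right 0. norm (S t x) < norm x + 1"
      by (rule order_tendstoD) simp
    then obtain d where d: "0 < d" "\<And>t. 0 < t \<Longrightarrow> t < d \<Longrightarrow> norm (S t x) < norm x + 1"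
      by (auto simp: eventually_at_right_field)
    obtain k1 where k1: "norm x + 1 \<le> real k1" using real_arch_simple by blast
    obtain k2 where k2: "inverse (real (Suc k2)) < d" using reals_Archimedean d(1) by blast
    have "1 / real (Suc (max k1 k2)) \<le> 1 / real (Suc k2)"
      by (intro divide_left_mono) auto
    then have "1 / real (Suc (max k1 k2)) < d" using k2 by (simp add: inverse_eq_divide)
    then have "x \<in> G (max k1 k2)"
      unfolding G_def using d(2) k1 by fastforce
    then show ?thesis by blast
  qed
  then have U: "\<Union>(range G) = UNIV" by blast
  have "\<exists>k. interior (G k) \<noteq> {}"
  proof (rule ccontr)
    assume "\<nexists>k. interior (G k) \<noteq> {}"
    then have "Met_TC.mtopology interior_of \<Union>(range G) = {}"
      using closed_G by (intro Met_TC.metric_Baire_category_alt) (auto simp: complete_UNIV)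
    then show False using U by simp
  qed
  then obtain k y where "y \<in> interior (G k)" by blast
  then obtain r where r: "0 < r" "cball y r \<subseteq> G k"
    using mem_interior_cball by blast
  \<comment> \<open>On the ball around \<open>y\<close> all values are bounded by \<open>k\<close>.
    Subtracting the value at the centre transfers this to every direction \<open>x\<close>, at the
    cost of the factor \<open>2 * real k / r\<close>.\<close>
  have key: "norm (S t x) \<le> (2 * real k / r) * norm x" if t: "0 < t" "t \<le> 1 / Suc k" for t x
  proof (cases "x = 0")
    case True
    then show ?thesis using linear_0[OF bounded_linear.linear[OF bl]] t by simp
  next
    case False
    interpret bounded_linear "S t" using bl t by simp
    define z where "z = y + (r / norm x) *\<^sub>R x"
    have "z \<in> cball y r" using False r by (simp add: z_def dist_norm)
    then have "norm (S t z) \<le> k" using r t unfolding G_def by fastforce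
    moreover have "y \<in> cball y r" using r by simp
    then have "norm (S t y) \<le> k" using r(2) t unfolding G_def by fastforce
    moreover have "(r / norm x) *\<^sub>R S t x = S t z - S t y"
      by (simp add: z_def add scaleR)
    then have "r / norm x * norm (S t x) \<le> norm (S t z) + norm (S t y)"
      using r(1) by (metis abs_of_pos divide_pos_pos False norm_scaleR norm_triangle_ineq4 zero_less_norm_iff)
    ultimately have "r / norm x * norm (S t x) \<le> 2 * k" by linarith
    then show ?thesis using r(1) False by (simp add: field_simps)
  qed
  show ?thesis
  proof
    show "0 < 1 / real (Suc k)" "0 \<le> max 1 (2 * real k / r)" by auto
    fix t x assume "0 \<le> t" "t \<le> 1 / real (Suc k)"
    then show "norm (S t x) \<le> max 1 (2 * real k / r) * norm x"
    proof (cases "t = 0")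
      case True
      then show ?thesis using C0_semigroup_0[OF S] mult_right_mono[of 1 "max 1 (2 * real k / r)" "norm x"] by simp
    next
      case False
      with \<open>0 \<le> t\<close> \<open>t \<le> _\<close> key[of t x] have "norm (S t x) \<le> (2 * real k / r) * norm x" by simp
      also have "\<dots> \<le> max 1 (2 * real k / r) * norm x" by (rule mult_right_mono) auto
      finally show ?thesis .
    qed
  qed
qed

text \<open>The bound near 0 is iterated with the semigroup law, peeling off one step of length
  \<delta> at a time.\<close>

lemma C0_semigroup_locally_bounded:
  fixes S :: "real \<Rightarrow> 'a::banach \<Rightarrow> 'a"
  assumes S: "C0_semigroup S"
  obtains N where "0 \<le> N" "\<And>t x. 0 \<le> t \<Longrightarrow> t \<le> T \<Longrightarrow> norm (S t x) \<le> N * norm x"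
proof -
  obtain \<delta> N where d: "0 < \<delta>" "0 \<le> N"
    and N: "\<And>t x. 0 \<le> t \<Longrightarrow> t \<le> \<delta> \<Longrightarrow> norm (S t x) \<le> N * norm x"
    using C0_semigroup_bounded_near_0[OF S] by blast
  \<comment> \<open>A constant at least 1 makes the powers of \<open>K\<close> increasing, so a
    single power serves all smaller times.\<close>
  define K where "K = max 1 N"
  have K: "1 \<le> K" "\<And>t x. 0 \<le> t \<Longrightarrow> t \<le> \<delta> \<Longrightarrow> norm (S t x) \<le> K * norm x"
    using N by (auto simp: K_def intro!: order_trans[OF N] mult_right_mono)
  have *: "norm (S t x) \<le> K ^ Suc k * norm x" if "0 \<le> t" "t \<le> real (Suc k) * \<delta>" for k t x
    using that
  proof (induction k arbitrary: t)
    case 0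
    then show ?case using K(2) by simp
  next
    case (Suc k)
    show ?case
    proof (cases "t \<le> \<delta>")
      case True
      have "K ^ 1 \<le> K ^ Suc (Suc k)" using K(1) by (intro power_increasing) auto
      then show ?thesis using K(2)[of t x] True Suc.prems
        by (metis mult_right_mono norm_ge_zero order_trans power_one_right)
    next
      case False
      then have "S t x = S \<delta> (S (t - \<delta>) x)"
        using C0_semigroup_add[OF S, of \<delta> "t - \<delta>" x] d by simp
      also have "norm \<dots> \<le> K * norm (S (t - \<delta>) x)" using K(2) d by simp
      also have "\<dots> \<le> K * (K ^ Suc k * norm x)"
        using Suc.prems False K(1) by (intro mult_left_mono Suc.IH) (auto simp: algebra_simps)
      finally show ?thesis by (simp add: mult.assoc)
    qed
  qed
  obtain k where "T / \<delta> \<le> real k" using real_arch_simple by blast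
  then have k: "T \<le> real (Suc k) * \<delta>" using d by (simp add: field_simps)
  show ?thesis
    using K(1) * k by (intro that[of "K ^ Suc k"]) (auto intro: order_trans)
qed

text \<open>Time and vector vary together: the change in the vector is absorbed by the local bound
  on \<open>S\<close>, and the change in time is reduced to strong continuity at 0.\<close>

lemma C0_semigroup_continuous_on:
  fixes S :: "real \<Rightarrow> 'a::banach \<Rightarrow> 'a"
  assumes S: "C0_semigroup S"
    and a: "continuous_on I a" "\<And>s. s \<in> I \<Longrightarrow> 0 \<le> a s" and y: "continuous_on I y"
  shows "continuous_on I (\<lambda>s. S (a s) (y s))"
  unfolding continuous_on_def
proof
  fix s0 assume s0: "s0 \<in> I"
  let ?F = "at s0 within I"
  define T where "T = a s0 + 1"
  obtain N where N: "0 \<le> N" "\<And>t x. 0 \<le> t \<Longrightarrow> t \<le> T \<Longrightarrow> norm (S t x) \<le> N * norm x"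
    using C0_semigroup_locally_bounded[OF S] by blast
  have bl: "bounded_linear (S t)" if "0 \<le> t" for t
    using S that by (rule C0_semigroup_bounded_linear)
  define v where "v = y s0"
  have lim_a: "(a \<longlongrightarrow> a s0) ?F" and lim_y: "(y \<longlongrightarrow> v) ?F"
    using a y s0 by (auto simp: continuous_on_def v_def)
  have ev: "\<forall>\<^sub>F s in ?F. 0 \<le> a s \<and> a s \<le> T"
  proof -
    have "\<forall>\<^sub>F s in ?F. a s < T" using lim_a by (rule order_tendstoD) (simp add: T_def)
    moreover have "\<forall>\<^sub>F s in ?F. s \<in> I" by (simp add: eventually_at_filter)
    ultimately show ?thesis by eventually_elim (use a in auto)
  qed
  \<comment> \<open>Factoring out the operator at the smaller time leaves only the increment of the
    orbit of \<open>v\<close> between 0 and \<open>\<bar>t - u\<bar>\<close>.\<close>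
  have le: "norm (S t v - S u v) \<le> N * norm (S \<bar>t - u\<bar> v - v)"
    if "0 \<le> t" "t \<le> T" "0 \<le> u" "u \<le> T" for t u
  proof -
    have *: "norm (S t v - S u v) \<le> N * norm (S \<bar>t - u\<bar> v - v)" if "u \<le> t" "0 \<le> u" "u \<le> T" for t u
    proof -
      have "S t v - S u v = S u (S \<bar>t - u\<bar> v - v)"
        using that C0_semigroup_add[OF S, of u "t - u" v] bl[of u]
        by (simp add: linear_diff bounded_linear.linear)
      then show ?thesis using N(2) that by simp
    qed
    show ?thesis
      using *[of u t] *[of t u] that by (cases "u \<le> t") (auto simp: abs_minus_commute norm_minus_commute)
  qed
  have "((\<lambda>t. S t v) \<longlongrightarrow> v) (at_right 0)"
    using S by (simp add: C0_semigroup_def)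
  then have "((\<lambda>t. S t v - v) \<longlongrightarrow> 0) (at_right 0)" by (simp add: LIM_zero)
  then have r: "((\<lambda>t. S t v - v) \<longlongrightarrow> 0) (at 0 within {0..})"
    by (subst at_within_Ici_at_right) 
  have abs_lim: "filterlim (\<lambda>s. \<bar>a s - a s0\<bar>) (nhds 0) ?F"
    using tendsto_rabs[OF tendsto_diff[OF lim_a tendsto_const[of "a s0"]]] by simp
  have "continuous (at 0 within {0..}) (\<lambda>t. S t v - v)"
    using r by (simp add: continuous_within C0_semigroup_0[OF S])
  then have "((\<lambda>s. S \<bar>a s - a s0\<bar> v - v) \<longlongrightarrow> 0) ?F"
    using continuous_within_tendsto_compose[OF _ _ abs_lim, of "{0..}" "\<lambda>t. S t v - v"]
    by (simp add: C0_semigroup_0[OF S])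
  then have 1: "((\<lambda>s. N * norm (S \<bar>a s - a s0\<bar> v - v) + N * norm (y s - v)) \<longlongrightarrow> N * norm (0::'a) + N * norm (v - v)) ?F"
    by (intro tendsto_intros lim_y)
  show "((\<lambda>s. S (a s) (y s)) \<longlongrightarrow> S (a s0) (y s0)) ?F"
  proof (rule Lim_null_comparison[THEN LIM_zero_cancel])
    show "\<forall>\<^sub>F s in ?F. norm (S (a s) (y s) - S (a s0) (y s0))
        \<le> N * norm (S \<bar>a s - a s0\<bar> v - v) + N * norm (y s - v)"
      using ev
    proof eventually_elim
      case (elim s)
      have "S (a s) (y s) - S (a s0) (y s0) = S (a s) (y s - v) + (S (a s) v - S (a s0) v)"
        using bl[of "a s"] elim by (simp add: linear_diff bounded_linear.linear v_def)
      also have "norm \<dots> \<le> N * norm (y s - v) + N * norm (S \<bar>a s - a s0\<bar> v - v)"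
        using elim a s0 by (intro norm_triangle_mono N le) (auto simp: T_def)
      finally show ?case by simp
    qed
  qed (use 1 in simp)
qed

section \<open>Bochner integrals over intervals and convolutions with the semigroup\<close>

lemma bounded_continuous_set_integrable:
  fixes h :: "real \<Rightarrow> 'a::{banach, second_countable_topology}"
  assumes c: "continuous_on {a<..b} h" and B: "\<And>s. s \<in> {a<..b} \<Longrightarrow> norm (h s) \<le> B"
  shows "set_integrable lborel {a..b} h"
proof (cases "a \<le> b")
  case True
  \<comment> \<open>The value at \<open>a\<close> is arbitrary, since the paths in question are
    continuous in E only away from 0. It enters through the indicator of a single point.\<close>
  have "(\<lambda>s. indicator {a<..b} s *\<^sub>R h s + indicator {a} s *\<^sub>R h a) \<in> borel_measurable borel"
    by (intro borel_measurable_add borel_measurable_continuous_on_indicator c) auto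
  also have "(\<lambda>s. indicator {a<..b} s *\<^sub>R h s + indicator {a} s *\<^sub>R h a) = (\<lambda>s. indicator {a..b} s *\<^sub>R h s)"
    using True by (auto simp: indicator_def fun_eq_iff)
  finally have m: "(\<lambda>s. indicator {a..b} s *\<^sub>R h s) \<in> borel_measurable borel" .
  show ?thesis
    unfolding set_integrable_def
  proof (rule integrableI_bounded_set[where A = "{a..b}" and B = B])
    show "AE s in lborel. s \<in> {a..b} \<longrightarrow> norm (indicator {a..b} s *\<^sub>R h s) \<le> B"
      using AE_lborel_singleton[of a] by eventually_elim (use B in \<open>auto simp: indicator_def\<close>)
  qed (use m True in auto)
qed (simp add: set_integrable_def)

lemma norm_set_integral_le:
  fixes h :: "real \<Rightarrow> 'a::{banach, second_countable_topology}"
  assumes i: "set_integrable lborel {a..b} h" and ab: "a \<le> b"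
    and B: "\<And>s. s \<in> {a<..b} \<Longrightarrow> norm (h s) \<le> B"
  shows "norm (LINT s:{a..b}|lborel. h s) \<le> B * (b - a)"
proof -
  have "norm (LINT s:{a..b}|lborel. h s) \<le> (\<integral>s. norm (indicator {a..b} s *\<^sub>R h s) \<partial>lborel)"
    unfolding set_lebesgue_integral_def by (rule integral_norm_bound)
  also have "\<dots> \<le> (\<integral>s. indicator {a..b} s *\<^sub>R B \<partial>lborel)"
  proof (rule integral_mono_AE)
    show "AE s in lborel. norm (indicator {a..b} s *\<^sub>R h s) \<le> indicator {a..b} s *\<^sub>R B"
      using AE_lborel_singleton[of a] by eventually_elim (use B in \<open>auto simp: indicator_def\<close>)
  next
    show "integrable lborel (\<lambda>s. norm (indicator {a..b} s *\<^sub>R h s))"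
      using i unfolding set_integrable_def by (rule integrable_norm)
    show "integrable lborel (\<lambda>s. indicator {a..b} s *\<^sub>R B)"
      using ab by (intro integrable_scaleR_left) simp
  qed
  also have "\<dots> = B * (b - a)" using ab by simp
  finally show ?thesis .
qed

lemma C0_convolution_integrable:
  fixes S :: "real \<Rightarrow> 'a::{banach, second_countable_topology} \<Rightarrow> 'a"
  assumes S: "C0_semigroup S" and q: "continuous_on {a<..b} q"
    and B: "\<And>s. s \<in> {a<..b} \<Longrightarrow> norm (q s) \<le> B" and bt: "b \<le> t"
  shows "set_integrable lborel {a..b} (\<lambda>s. S (t - s) (q s))"
proof -
  obtain N where N: "0 \<le> N" "\<And>u x. 0 \<le> u \<Longrightarrow> u \<le> t - a \<Longrightarrow> norm (S u x) \<le> N * norm x"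
    using C0_semigroup_locally_bounded[OF S] by blast
  show ?thesis
  proof (rule bounded_continuous_set_integrable)
    show "continuous_on {a<..b} (\<lambda>s. S (t - s) (q s))"
      using bt q by (intro C0_semigroup_continuous_on[OF S] continuous_intros) auto
    show "norm (S (t - s) (q s)) \<le> N * B" if "s \<in> {a<..b}" for s
      using that bt N(1) B[OF that] by (intro order_trans[OF N(2)] mult_left_mono) auto
  qed
qed

text \<open>On \<open>{0..r}\<close> the semigroup law lets the bounded operator
  \<open>S (t - r)\<close> be pulled out of the integral. This is what allows a mild equation to be
  restarted at \<open>r\<close>.\<close>

lemma C0_convolution_split:
  fixes S :: "real \<Rightarrow> 'a::{banach, second_countable_topology} \<Rightarrow> 'a"
  assumes S: "C0_semigroup S" and q: "continuous_on {0<..t} q"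
    and B: "\<And>s. s \<in> {0<..t} \<Longrightarrow> norm (q s) \<le> B" and r: "0 \<le> r" "r \<le> t"
  shows "(LINT s:{0..t}|lborel. S (t - s) (q s)) =
    S (t - r) (LINT s:{0..r}|lborel. S (r - s) (q s)) + (LINT s:{r..t}|lborel. S (t - s) (q s))"
proof -
  have qr: "continuous_on {0<..r} q" "continuous_on {r<..t} q"
    using q r by (auto intro: continuous_on_subset)
  have bl: "bounded_linear (S (t - r))"
    using r by (intro C0_semigroup_bounded_linear[OF S]) simp
  have i0: "set_integrable lborel {0..r} (\<lambda>s. S (r - s) (q s))"
    by (rule C0_convolution_integrable[OF S qr(1), of B]) (use B r in auto)
  have i1: "set_integrable lborel {0..r} (\<lambda>s. S (t - s) (q s))"
    by (rule C0_convolution_integrable[OF S qr(1), of B]) (use B r in auto)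
  have i2: "set_integrable lborel {r..t} (\<lambda>s. S (t - s) (q s))"
    by (rule C0_convolution_integrable[OF S qr(2), of B]) (use B r in auto)
  have "(LINT s:{0..r}|lborel. S (t - s) (q s)) = (LINT s:{0..r}|lborel. S (t - r) (S (r - s) (q s)))"
  proof (rule set_lebesgue_integral_cong)
    show "\<forall>s. s \<in> {0..r} \<longrightarrow> S (t - s) (q s) = S (t - r) (S (r - s) (q s))"
      using r by (auto simp flip: C0_semigroup_add[OF S])
  qed simp
  also have "\<dots> = (\<integral>s. S (t - r) (indicator {0..r} s *\<^sub>R S (r - s) (q s)) \<partial>lborel)"
    unfolding set_lebesgue_integral_def by (simp add: linear_scale[OF bounded_linear.linear[OF bl]])
  also have "\<dots> = S (t - r) (LINT s:{0..r}|lborel. S (r - s) (q s))"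
    unfolding set_lebesgue_integral_def
    by (rule integral_bounded_linear[OF bl]) (use i0 in \<open>simp add: set_integrable_def\<close>)
  finally have e: "(LINT s:{0..r}|lborel. S (t - s) (q s)) = S (t - r) (LINT s:{0..r}|lborel. S (r - s) (q s))" .
  have "{0..t} = {0..r} \<union> {r..t}" using r by auto
  then have "(LINT s:{0..t}|lborel. S (t - s) (q s)) = (LINT s:{0..r} \<union> {r..t}|lborel. S (t - s) (q s))"
    by simp
  also have "\<dots> = (LINT s:{0..r}|lborel. S (t - s) (q s)) + (LINT s:{r..t}|lborel. S (t - s) (q s))"
  proof (rule set_integral_Un_AE)
    show "AE s in lborel. \<not> (s \<in> {0..r} \<and> s \<in> {r..t})"
      using AE_lborel_singleton[of r] by eventually_elim auto
  qed (use i1 i2 in auto)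
  finally show ?thesis by (simp add: e)
qed

text \<open>Dominated convergence along sequences of times: with the indicator of
  \<open>{0..t}\<close> inside, all integrands live on the fixed interval
  \<open>{0..T}\<close>.\<close>

lemma C0_convolution_continuous_on:
  fixes S :: "real \<Rightarrow> 'a::{banach, second_countable_topology} \<Rightarrow> 'a"
  assumes S: "C0_semigroup S" and q: "continuous_on {0<..T} q"
    and B: "\<And>s. s \<in> {0<..T} \<Longrightarrow> norm (q s) \<le> B"
  shows "continuous_on {0..T} (\<lambda>t. LINT s:{0..t}|lborel. S (t - s) (q s))"
  unfolding continuous_on_sequentially comp_def
proof (intro allI ballI impI)
  fix u :: "nat \<Rightarrow> real" and t
  assume t: "t \<in> {0..T}" and "(\<forall>n. u n \<in> {0..T}) \<and> u \<longlonglongrightarrow> t"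
  then have u: "\<And>n. u n \<in> {0..T}" "u \<longlonglongrightarrow> t" by auto
  obtain N where N: "0 \<le> N" "\<And>u x. 0 \<le> u \<Longrightarrow> u \<le> T \<Longrightarrow> norm (S u x) \<le> N * norm x"
    using C0_semigroup_locally_bounded[OF S] by blast
  have i: "set_integrable lborel {0..t} (\<lambda>s. S (t - s) (q s))" if "t \<in> {0..T}" for t
    by (rule C0_convolution_integrable[OF S, of _ _ _ B])
      (use that B in \<open>auto intro: continuous_on_subset[OF q]\<close>)
  show "(\<lambda>n. LINT s:{0..u n}|lborel. S (u n - s) (q s)) \<longlonglongrightarrow> (LINT s:{0..t}|lborel. S (t - s) (q s))"
    unfolding set_lebesgue_integral_def
  proof (rule integral_dominated_convergence[where w = "\<lambda>s. indicator {0..T} s * (N * B)"])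
    show "(\<lambda>s. indicator {0..t} s *\<^sub>R S (t - s) (q s)) \<in> borel_measurable lborel"
      "(\<lambda>s. indicator {0..u n} s *\<^sub>R S (u n - s) (q s)) \<in> borel_measurable lborel" for n
      using i[OF t] i[OF u(1)] by (auto simp: set_integrable_def dest: borel_measurable_integrable)
    show "integrable lborel (\<lambda>s. indicator {0..T} s * (N * B))"
      using t by (intro integrable_mult_left) simp
    show "AE s in lborel. norm (indicator {0..u n} s *\<^sub>R S (u n - s) (q s)) \<le> indicator {0..T} s * (N * B)" for n
      using AE_lborel_singleton[of 0]
    proof eventually_elim
      case (elim s)
      show ?case
      proof (cases "s \<in> {0..u n}")
        case True
        with elim u(1)[of n] have s: "s \<in> {0<..T}" "0 \<le> u n - s" "u n - s \<le> T" by auto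
        have "norm (S (u n - s) (q s)) \<le> N * B"
          using N(1) B[OF s(1)] by (intro order_trans[OF N(2)] mult_left_mono s)
        then show ?thesis using True s by simp
      next
        case False
        have "0 \<le> N * B" if "s \<in> {0..T}"
        proof -
          have "0 \<le> B" using B[of s] that elim order_trans[OF norm_ge_zero] by auto
          then show ?thesis using N(1) by simp
        qed
        then show ?thesis using False by (auto simp: indicator_def)
      qed
    qed
    \<comment> \<open>The point \<open>s = t\<close> is discarded because the indicators of
      \<open>{0..u n}\<close> may oscillate there.\<close>
    show "AE s in lborel. (\<lambda>n. indicator {0..u n} s *\<^sub>R S (u n - s) (q s))
        \<longlonglongrightarrow> indicator {0..t} s *\<^sub>R S (t - s) (q s)"
      using AE_lborel_singleton[of t]
    proof eventually_elim
      case (elim s)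
      consider "s < 0" | "t < s" | "0 \<le> s" "s < t" using elim by linarith
      then show ?case
      proof cases
        case 2
        then have "\<forall>\<^sub>F n in sequentially. u n < s" using u(2) by (rule order_tendstoD[rotated])
        then have "\<forall>\<^sub>F n in sequentially. indicator {0..u n} s *\<^sub>R S (u n - s) (q s) = 0"
          by eventually_elim auto
        then show ?thesis using 2 by (simp add: tendsto_eventually)
      next
        case 3
        have ev: "\<forall>\<^sub>F n in sequentially. s < u n" using u(2) 3(2) by (rule order_tendstoD)
        have "continuous_on {s..} (\<lambda>v. S (v - s) (q s))"
          by (intro C0_semigroup_continuous_on[OF S] continuous_intros) auto
        then have "(\<lambda>n. S (u n - s) (q s)) \<longlonglongrightarrow> S (t - s) (q s)"
          by (rule continuous_on_tendsto_compose[OF _ u(2)]) (use 3 ev in \<open>auto elim: eventually_mono\<close>)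
        then show ?thesis
        proof (rule Lim_transform_eventually[THEN tendsto_eq_rhs])
          show "\<forall>\<^sub>F n in sequentially. S (u n - s) (q s) = indicator {0..u n} s *\<^sub>R S (u n - s) (q s)"
            using ev by eventually_elim (use 3 in auto)
        qed (use 3 in auto)
      qed auto
    qed
  qed
qed

section \<open>Resolvents and the regularized convolution\<close>

text \<open>The convolution is differentiated from the right only, so the mean value inequality is
  obtained from an infimum argument: at the first place where an increment bound with small slope
  \<open>e\<close> could fail, the right quotient is still below \<open>e\<close> and carries the
  bound further.\<close>

lemma zero_right_derivative_imp_eq:
  fixes f :: "real \<Rightarrow> 'a::real_normed_vector"
  assumes ab: "a \<le> b" and f: "continuous_on {a..b} f"
    and d: "\<And>t. a \<le> t \<Longrightarrow> t < b \<Longrightarrow> ((\<lambda>h. (f (t + h) - f t) /\<^sub>R h) \<longlongrightarrow> 0) (at_right 0)"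
  shows "f b = f a"
proof -
  have le: "norm (f b - f a) \<le> e * (b - a)" if e: "0 < e" for e
  proof (rule ccontr)
    define G where "G = {s \<in> {a..b}. norm (f s - f a) \<le> e * (s - a)}"
    define B where "B = {a..b} - G"
    assume "\<not> ?thesis"
    then have "b \<in> B" using ab by (simp add: B_def G_def)
    have bdd: "bdd_below B" by (auto simp: B_def intro: bdd_belowI[of _ a])
    define c where "c = Inf B"
    have "a \<le> c" using \<open>b \<in> B\<close> by (auto simp: c_def B_def intro!: cInf_greatest)
    have "c \<le> b" using \<open>b \<in> B\<close> bdd by (auto simp: c_def intro: cInf_lower)
    have below: "s \<in> G" if "a \<le> s" "s < c" for s
      using that \<open>c \<le> b\<close> cInf_lower[OF _ bdd, of s] by (force simp: B_def c_def)
    have "closed G"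
    proof -
      have "closedin (top_of_set {a..b}) ({a..b} \<inter> (\<lambda>s. norm (f s - f a) - e * (s - a)) -` {..0})"
        by (intro continuous_closedin_preimage continuous_intros f closed_atMost)
      also have "{a..b} \<inter> (\<lambda>s. norm (f s - f a) - e * (s - a)) -` {..0} = G" by (auto simp: G_def)
      finally show ?thesis by (rule closedin_closed_trans) simp
    qed
    have "c \<in> G"
    proof (cases "c = a")
      case True
      then show ?thesis using ab by (simp add: G_def)
    next
      case False
      with \<open>a \<le> c\<close> have "a < c" by simp
      have "closure {a..<c} \<subseteq> G" using below \<open>closed G\<close> by (intro closure_minimal) auto
      then show ?thesis using \<open>a < c\<close> by auto
    qed
    have "c < b" using \<open>b \<in> B\<close> \<open>c \<in> G\<close> \<open>c \<le> b\<close> by (cases "c = b") (auto simp: B_def)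
    have "\<forall>\<^sub>F h in at_right 0. norm ((f (c + h) - f c) /\<^sub>R h) < e"
      using tendsto_norm[OF d[OF \<open>a \<le> c\<close> \<open>c < b\<close>]] e by (intro order_tendstoD) auto
    then obtain k where k: "0 < k" "\<And>h. 0 < h \<Longrightarrow> h < k \<Longrightarrow> norm ((f (c + h) - f c) /\<^sub>R h) < e"
      by (auto simp: eventually_at_right_field)
    \<comment> \<open>Every failing point lies at distance at least \<open>k\<close> to the right of
      \<open>c\<close>, although \<open>c\<close> is their infimum.\<close>
    have "c + k \<le> c"
      unfolding c_def
    proof (rule cInf_greatest, use \<open>b \<in> B\<close> in blast, rule ccontr)
      fix s assume s: "s \<in> B" "\<not> Inf B + k \<le> s"
      have "c \<le> s" using s bdd by (auto simp: c_def intro: cInf_lower)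
      with \<open>c \<in> G\<close> s have "c < s" by (cases "c = s") (auto simp: B_def)
      then have "norm ((f s - f c) /\<^sub>R (s - c)) < e" using k(2)[of "s - c"] s by (simp add: c_def)
      then have "norm (f s - f c) / (s - c) < e" using \<open>c < s\<close> by (simp add: divide_inverse mult.commute)
      then have "norm (f s - f c) \<le> e * (s - c)" using \<open>c < s\<close> by (simp add: pos_divide_less_eq)
      moreover have "norm (f s - f a) \<le> norm (f s - f c) + norm (f c - f a)"
        using norm_triangle_ineq[of "f s - f c" "f c - f a"] by simp
      moreover have "norm (f c - f a) \<le> e * (c - a)" using \<open>c \<in> G\<close> by (simp add: G_def)
      ultimately have "norm (f s - f a) \<le> e * (s - a)" by (simp add: algebra_simps)
      then show False using s by (auto simp: B_def G_def)
    qed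
    then show False using k by simp
  qed
  have "norm (f b - f a) \<le> 0"
  proof (rule field_le_epsilon)
    fix e :: real assume e: "0 < e"
    have "norm (f b - f a) \<le> e / (b - a + 1) * (b - a)" using e ab by (intro le) simp
    also have "\<dots> \<le> e" using e ab by (simp add: field_simps)
    finally show "norm (f b - f a) \<le> 0 + e" by simp
  qed
  then show ?thesis by simp
qed

text \<open>The operator \<open>R\<close> is a parameter, so that later arguments rest on
  boundedness and the two inverse identities and not on the choice made by
  \<open>inv_into\<close>.\<close>

definition real_resolvent ::
    "'a::real_normed_vector set \<Rightarrow> ('a \<Rightarrow> 'a) \<Rightarrow> real \<Rightarrow> ('a \<Rightarrow> 'a) \<Rightarrow> bool" where
  "real_resolvent D A \<mu> R \<longleftrightarrow> bounded_linear R \<and> (\<forall>y. R y \<in> D \<and> \<mu> *\<^sub>R R y - A (R y) = y) \<and>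
     (\<forall>x\<in>D. R (\<mu> *\<^sub>R x - A x) = x)"

text \<open>For real \<mu> the complexified shift acts on the two components separately, so the real
  resolvent is the first component of the complex one on pairs \<open>(y, 0)\<close>.\<close>

lemma resolvent_set_imp_real_resolvent:
  assumes A: "linear_operator D A" and r: "of_real \<mu> \<in> resolvent_set D A"
  shows "real_resolvent D A \<mu> (resolvent D A \<mu>)"
proof -
  let ?f = "\<lambda>z. \<mu> *\<^sub>R z - A z"
  let ?c = "cx_resolvent D A (of_real \<mu>)"
  have cx: "cx_shift A (of_real \<mu>) (x, y) = (?f x, ?f y)" for x y
    by (simp add: cx_shift_def)
  have bij: "bij_betw (cx_shift A (of_real \<mu>)) (D \<times> D) UNIV" and bl: "bounded_linear ?c"
    using r by (auto simp: resolvent_set_def)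
  have D0: "0 \<in> D" using A by (simp add: linear_operator_def subspace_0)
  have inj: "inj_on ?f D"
  proof (rule inj_onI)
    fix x y assume xy: "x \<in> D" "y \<in> D" "?f x = ?f y"
    then have "cx_shift A (of_real \<mu>) (x, 0) = cx_shift A (of_real \<mu>) (y, 0)" by (simp add: cx)
    then have "(x, 0::'a) = (y, 0)"
      by (rule inj_onD[OF bij_betw_imp_inj_on[OF bij]]) (use xy D0 in auto)
    then show "x = y" by simp
  qed
  have R: "fst (?c (y, 0)) \<in> D \<and> ?f (fst (?c (y, 0))) = y" for y
  proof -
    have "?c (y, 0) \<in> D \<times> D"
      unfolding cx_resolvent_def using bij by (intro inv_into_into) (auto simp: bij_betw_def)
    moreover have "cx_shift A (of_real \<mu>) (?c (y, 0)) = (y, 0)"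
      unfolding cx_resolvent_def using bij by (intro f_inv_into_f) (auto simp: bij_betw_def)
    ultimately show ?thesis by (cases "?c (y, 0)") (auto simp: cx)
  qed
  have eq: "resolvent D A \<mu> y = fst (?c (y, 0))" for y
    unfolding resolvent_def using R[of y] inj by (intro inv_into_f_eq) auto
  have "bounded_linear (\<lambda>y. fst (?c (y, 0)))"
  proof (rule bounded_linear_compose[OF bounded_linear_fst bounded_linear_compose[OF bl]])
    show "bounded_linear (\<lambda>y. (y, 0::'a))" by (intro bounded_linear_Pair bounded_linear_ident bounded_linear_zero)
  qed
  then have "bounded_linear (resolvent D A \<mu>)" by (simp add: eq[abs_def])
  then show ?thesis
    unfolding real_resolvent_def
  proof (intro conjI allI ballI)
    show "resolvent D A \<mu> y \<in> D" "\<mu> *\<^sub>R resolvent D A \<mu> y - A (resolvent D A \<mu> y) = y" for y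
      using R[of y] by (simp_all add: eq)
    show "resolvent D A \<mu> (\<mu> *\<^sub>R x - A x) = x" if "x \<in> D" for x
      unfolding resolvent_def using inj that by (rule inv_into_f_f)
  qed
qed

lemma sectorial_linear_operator: "sectorial D A \<Longrightarrow> linear_operator D A"
  by (simp add: sectorial_def)

lemma sectorial_imp_real_resolvent:
  assumes "sectorial D A"
  obtains \<omega> where "\<And>\<mu>. \<omega> < \<mu> \<Longrightarrow> real_resolvent D A \<mu> (resolvent D A \<mu>)"
proof -
  obtain \<omega> \<theta> :: real where th: "pi / 2 < \<theta>"
    and r: "\<And>z. z \<noteq> of_real \<omega> \<Longrightarrow> \<bar>Arg (z - of_real \<omega>)\<bar> < \<theta> \<Longrightarrow> z \<in> resolvent_set D A"
    using assms unfolding sectorial_def by blast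
  have "of_real \<mu> \<in> resolvent_set D A" if "\<omega> < \<mu>" for \<mu>
  proof (rule r)
    have "Arg (complex_of_real \<mu> - of_real \<omega>) = 0"
      using that by (simp flip: of_real_diff add: Arg_of_real)
    then show "\<bar>Arg (complex_of_real \<mu> - of_real \<omega>)\<bar> < \<theta>" using th pi_gt_zero by linarith
  qed (use that in simp)
  then show ?thesis
    using that resolvent_set_imp_real_resolvent[OF sectorial_linear_operator[OF assms]] by blast
qed

section \<open>Semigroup, generator and resolvent: commutation and differentiation\<close>

lemma generates_C0_semigroupD:
  assumes "generates_C0_semigroup D A S"
  shows "C0_semigroup S"
    and "x \<in> D \<Longrightarrow> ((\<lambda>h. (1 / h) *\<^sub>R (S h x - x)) \<longlongrightarrow> A x) (at_right 0)"
    and "((\<lambda>h. (1 / h) *\<^sub>R (S h x - x)) \<longlongrightarrow> y) (at_right 0) \<Longrightarrow> x \<in> D"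
  using assms unfolding generates_C0_semigroup_def by blast+

text \<open>The bounded operator \<open>S t\<close> may be applied to the difference quotient at
  \<open>w\<close>, which by the semigroup law becomes the quotient at \<open>S t w\<close>.\<close>

lemma generator_commutes:
  assumes g: "generates_C0_semigroup D A S" and t: "0 \<le> t" and w: "w \<in> D"
  shows "S t w \<in> D" "A (S t w) = S t (A w)"
proof -
  have S: "C0_semigroup S" by (rule generates_C0_semigroupD(1)[OF g])
  interpret bounded_linear "S t" using S t by (rule C0_semigroup_bounded_linear)
  have "((\<lambda>h. (1 / h) *\<^sub>R (S h w - w)) \<longlongrightarrow> A w) (at_right 0)"
    by (rule generates_C0_semigroupD(2)[OF g w])
  then have "((\<lambda>h. S t ((1 / h) *\<^sub>R (S h w - w))) \<longlongrightarrow> S t (A w)) (at_right 0)"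
    by (rule tendsto)
  moreover have "\<forall>\<^sub>F h in at_right 0. S t ((1 / h) *\<^sub>R (S h w - w)) = (1 / h) *\<^sub>R (S h (S t w) - S t w)"
  proof (rule eventually_at_right_less[THEN eventually_mono])
    fix h :: real assume "0 < h"
    then have "S t (S h w) = S h (S t w)"
      using t by (simp flip: C0_semigroup_add[OF S] add: add.commute)
    then show "S t ((1 / h) *\<^sub>R (S h w - w)) = (1 / h) *\<^sub>R (S h (S t w) - S t w)"
      by (simp add: scaleR diff)
  qed
  ultimately have lim: "((\<lambda>h. (1 / h) *\<^sub>R (S h (S t w) - S t w)) \<longlongrightarrow> S t (A w)) (at_right 0)"
    by (rule Lim_transform_eventually)
  then show d: "S t w \<in> D" by (rule generates_C0_semigroupD(3)[OF g])
  then have "((\<lambda>h. (1 / h) *\<^sub>R (S h (S t w) - S t w)) \<longlongrightarrow> A (S t w)) (at_right 0)"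
    by (rule generates_C0_semigroupD(2)[OF g])
  with lim show "A (S t w) = S t (A w)"
    by (auto intro: tendsto_unique[OF trivial_limit_at_right_real])
qed

lemma resolvent_commutes:
  assumes g: "generates_C0_semigroup D A S" and R: "real_resolvent D A \<mu> R" and t: "0 \<le> t"
  shows "R (S t y) = S t (R y)"
proof -
  have S: "C0_semigroup S" by (rule generates_C0_semigroupD(1)[OF g])
  interpret bounded_linear "S t" using S t by (rule C0_semigroup_bounded_linear)
  have Ry: "R y \<in> D" "\<mu> *\<^sub>R R y - A (R y) = y" using R by (auto simp: real_resolvent_def)
  have "S t y = S t (\<mu> *\<^sub>R R y - A (R y))" using Ry(2) by simp
  also have "\<dots> = \<mu> *\<^sub>R S t (R y) - A (S t (R y))"
    using generator_commutes[OF g t Ry(1)] by (simp add: diff scaleR)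
  finally have "S t y = \<mu> *\<^sub>R S t (R y) - A (S t (R y))" .
  moreover have "R (\<mu> *\<^sub>R S t (R y) - A (S t (R y))) = S t (R y)"
    using R generator_commutes(1)[OF g t Ry(1)] unfolding real_resolvent_def by blast
  ultimately show ?thesis by simp
qed

text \<open>The convolution need not lie in the domain of \<open>A\<close>, but its image under the
  resolvent does. Its value at \<open>t + h\<close> is the semigroup acting on the value at
  \<open>t\<close> plus a fresh integral over a short interval.\<close>

lemma resolvent_convolution_right_derivative:
  fixes S :: "real \<Rightarrow> 'a::{banach, second_countable_topology} \<Rightarrow> 'a"
  assumes g: "generates_C0_semigroup D A S" and R: "real_resolvent D A \<mu> R"
    and q: "continuous_on {0<..T} q"
    and B: "\<And>s. s \<in> {0<..T} \<Longrightarrow> norm (q s) \<le> B" and t: "0 < t" "t < T"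
  defines "z \<equiv> \<lambda>t. LINT s:{0..t}|lborel. S (t - s) (q s)"
  shows "((\<lambda>h. (R (z (t + h)) - R (z t)) /\<^sub>R h) \<longlongrightarrow> A (R (z t)) + R (q t)) (at_right 0)"
proof -
  have S: "C0_semigroup S" by (rule generates_C0_semigroupD(1)[OF g])
  have blR: "bounded_linear R" using R by (simp add: real_resolvent_def)
  have RD: "R y \<in> D" for y using R by (simp add: real_resolvent_def)
  define p where "p h = (LINT s:{t..t + h}|lborel. S (t + h - s) (q s))" for h
  have split: "z (t + h) = S h (z t) + p h" if "0 < h" "h < T - t" for h
  proof -
    have "continuous_on {0<..t + h} q" using that by (intro continuous_on_subset[OF q]) auto
    then show ?thesis
      unfolding z_def p_def
      using C0_convolution_split[OF S, of "t + h" q B t] that t B by simp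
  qed
  \<comment> \<open>\<open>p h /\<^sub>R h\<close> is a mean of \<open>S (t + h - s) (q s)\<close>
    over \<open>{t..t + h}\<close>, and \<open>S u (q s)\<close> is jointly continuous at
    \<open>u = 0\<close>, \<open>s = t\<close> with value \<open>q t\<close>.\<close>
  have p: "((\<lambda>h. p h /\<^sub>R h) \<longlongrightarrow> q t) (at_right 0)"
  proof (rule tendstoI)
    fix e :: real assume e: "0 < e"
    have "continuous_on ({0..} \<times> {0<..T}) (\<lambda>v. S (fst v) (q (snd v)))"
      by (intro C0_semigroup_continuous_on[OF S] continuous_intros continuous_on_compose2[OF q]) auto
    then have "((\<lambda>v. S (fst v) (q (snd v))) \<longlongrightarrow> S 0 (q t)) (at (0, t) within {0..} \<times> {0<..T})"
      using t by (force simp: continuous_on_def)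
    then have "\<forall>\<^sub>F v in at (0, t) within {0..} \<times> {0<..T}. dist (S (fst v) (q (snd v))) (S 0 (q t)) < e / 2"
      using e by (intro tendstoD) auto
    then obtain d where d: "0 < d"
      and de: "\<And>v. v \<in> {0..} \<times> {0<..T} \<Longrightarrow> v \<noteq> (0, t) \<Longrightarrow> dist v (0, t) < d \<Longrightarrow>
        dist (S (fst v) (q (snd v))) (S 0 (q t)) < e / 2"
      by (auto simp: eventually_at)
    have near: "norm (S u (q s) - q t) \<le> e / 2" if "0 \<le> u" "0 < s" "s \<le> T" "u < d / 2" "\<bar>s - t\<bar> < d / 2" for u s
    proof (cases "(u, s) = (0, t)")
      case True
      then show ?thesis using e by (simp add: C0_semigroup_0[OF S])
    next
      case False
      have "dist (u, s) (0, t) \<le> \<bar>u\<bar> + \<bar>s - t\<bar>"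
        by (simp add: dist_Pair_Pair dist_real_def sqrt_sum_squares_le_sum_abs)
      also have "\<dots> < d" using that by simp
      finally show ?thesis using de[of "(u, s)"] that False by (simp add: dist_norm C0_semigroup_0[OF S])
    qed
    have "\<forall>\<^sub>F h in at_right 0. h \<in> {0<..<min (d / 2) (T - t)}"
      using d t by (intro eventually_at_right_real) auto
    then show "\<forall>\<^sub>F h in at_right 0. dist (p h /\<^sub>R h) (q t) < e"
    proof eventually_elim
      case (elim h)
      then have h: "0 < h" "h < d / 2" "t + h \<le> T" by auto
      have i: "set_integrable lborel {t..t + h} (\<lambda>s. S (t + h - s) (q s))"
        using t h by (intro C0_convolution_integrable[OF S, of _ _ _ B] continuous_on_subset[OF q] B) auto
      have ic: "set_integrable lborel {t..t + h} (\<lambda>s. q t)"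
        using h unfolding set_integrable_def by (intro integrable_scaleR_left) simp
      have "(LINT s:{t..t + h}|lborel. q t) = h *\<^sub>R q t"
        using h unfolding set_lebesgue_integral_def by (subst integral_scaleR_left) auto
      then have "p h - h *\<^sub>R q t = (LINT s:{t..t + h}|lborel. S (t + h - s) (q s) - q t)"
        using set_integral_diff(2)[OF i ic] by (simp add: p_def)
      also have "norm \<dots> \<le> e / 2 * (t + h - t)"
        using h t by (intro norm_set_integral_le set_integral_diff(1) i ic near) auto
      finally have "norm (p h - h *\<^sub>R q t) \<le> e / 2 * h" by simp
      moreover have "p h - h *\<^sub>R q t = h *\<^sub>R (p h /\<^sub>R h - q t)"
        using h by (simp add: scaleR_diff_right)
      ultimately have "norm (p h /\<^sub>R h - q t) \<le> e / 2"
        using h by simp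
      then show ?case using e by (simp add: dist_norm)
    qed
  qed
  have "((\<lambda>h. (1 / h) *\<^sub>R (S h (R (z t)) - R (z t))) \<longlongrightarrow> A (R (z t))) (at_right 0)"
    by (rule generates_C0_semigroupD(2)[OF g RD])
  then have "((\<lambda>h. (1 / h) *\<^sub>R (S h (R (z t)) - R (z t)) + R (p h /\<^sub>R h)) \<longlongrightarrow> A (R (z t)) + R (q t)) (at_right 0)"
    by (intro tendsto_add bounded_linear.tendsto[OF blR p])
  moreover have "\<forall>\<^sub>F h in at_right 0. (1 / h) *\<^sub>R (S h (R (z t)) - R (z t)) + R (p h /\<^sub>R h) = (R (z (t + h)) - R (z t)) /\<^sub>R h"
    using eventually_at_right_real[of 0 "T - t"]
  proof (rule eventually_mono)
    fix h assume "h \<in> {0<..<T - t}"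
    then have h: "0 < h" "h < T - t" by auto
    interpret R: bounded_linear R by (rule blR)
    show "(1 / h) *\<^sub>R (S h (R (z t)) - R (z t)) + R (p h /\<^sub>R h) = (R (z (t + h)) - R (z t)) /\<^sub>R h"
      using h by (simp add: split[OF h] R.add R.scaleR resolvent_commutes[OF g R] inverse_eq_divide
          scaleR_add_right scaleR_diff_right)
  qed (use t in simp)
  ultimately show ?thesis by (rule Lim_transform_eventually)
qed

section \<open>Quasi-dissipative operators\<close>

text \<open>The sign \<open>c\<close> selects the side of approach: 1 gives the right quotient, -1
  the left one, which converges to the negative of the derivative.\<close>

lemma has_vector_derivative_quotient:
  assumes f: "(f has_vector_derivative f') (at x within I)"
    and c: "\<bar>c\<bar> = 1" and ev: "\<forall>\<^sub>F h in at_right 0. x + c * h \<in> I"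
  shows "((\<lambda>h. (f (x + c * h) - f x) /\<^sub>R h) \<longlongrightarrow> c *\<^sub>R f') (at_right 0)"
proof -
  let ?g = "\<lambda>y. (1 / norm (y - x)) *\<^sub>R (f y - (f x + (y - x) *\<^sub>R f'))"
  have "(?g \<longlongrightarrow> 0) (at x within I)"
    using f by (simp add: has_vector_derivative_def has_derivative_within)
  moreover have "filterlim (\<lambda>h. x + c * h) (at x within I) (at_right 0)"
    unfolding filterlim_at
  proof
    have "((\<lambda>h. x + c * h) \<longlongrightarrow> x + c * 0) (at_right 0)" by (intro tendsto_intros)
    then show "((\<lambda>h. x + c * h) \<longlongrightarrow> x) (at_right 0)" by simp
    show "\<forall>\<^sub>F h in at_right 0. x + c * h \<in> I \<and> x + c * h \<noteq> x"
      using ev eventually_at_right_less[of "0::real"] by eventually_elim (use c in auto)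
  qed
  ultimately have "((\<lambda>h. ?g (x + c * h)) \<longlongrightarrow> 0) (at_right 0)" by (rule filterlim_compose)
  then have "((\<lambda>h. ?g (x + c * h) + c *\<^sub>R f') \<longlongrightarrow> 0 + c *\<^sub>R f') (at_right 0)"
    by (intro tendsto_intros)
  moreover have "\<forall>\<^sub>F h in at_right 0. ?g (x + c * h) + c *\<^sub>R f' = (f (x + c * h) - f x) /\<^sub>R h"
    using eventually_at_right_less[of "0::real"]
  proof eventually_elim
    case (elim h)
    then have "norm (x + c * h - x) = h" using c by (simp add: abs_mult)
    then show ?case using elim by (simp add: algebra_simps inverse_eq_divide)
  qed
  ultimately show ?thesis using Lim_transform_eventually by fastforce
qed

lemma integral_right_quotient:
  fixes f :: "real \<Rightarrow> 'a::banach"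
  assumes "continuous_on {a..b} f" "a \<le> x" "x < b"
  shows "((\<lambda>h. (integral {a..x + h} f - integral {a..x} f) /\<^sub>R h) \<longlongrightarrow> f x) (at_right 0)"
proof -
  have "\<forall>\<^sub>F h in at_right 0. h \<in> {0<..<b - x}" using assms by (intro eventually_at_right_real) simp
  then have "\<forall>\<^sub>F h in at_right 0. x + 1 * h \<in> {a..b}" by eventually_elim (use assms in auto)
  then show ?thesis
    using has_vector_derivative_quotient[OF integral_has_vector_derivative[OF assms(1)], of x 1] assms by simp
qed

lemma integral_left_quotient:
  fixes f :: "real \<Rightarrow> 'a::banach"
  assumes "continuous_on {a..b} f" "a < x" "x \<le> b"
  shows "((\<lambda>h. integral {x - h..x} f /\<^sub>R h) \<longlongrightarrow> f x) (at_right 0)"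
proof -
  have ev: "\<forall>\<^sub>F h in at_right 0. h \<in> {0<..<x - a}" using assms by (intro eventually_at_right_real) simp
  then have "\<forall>\<^sub>F h in at_right 0. x + (-1) * h \<in> {a..b}" by eventually_elim (use assms in auto)
  then have "((\<lambda>h. - ((integral {a..x + (-1) * h} f - integral {a..x} f) /\<^sub>R h)) \<longlongrightarrow> - ((-1) *\<^sub>R f x)) (at_right 0)"
    using assms by (intro tendsto_minus has_vector_derivative_quotient[OF integral_has_vector_derivative[OF assms(1)]]) auto
  moreover have "\<forall>\<^sub>F h in at_right 0. - ((integral {a..x + (-1) * h} f - integral {a..x} f) /\<^sub>R h) = integral {x - h..x} f /\<^sub>R h"
    using ev
  proof eventually_elim
    case (elim h)
    have "integral {a..x - h} f + integral {x - h..x} f = integral {a..x} f"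
      using assms elim
      by (intro Henstock_Kurzweil_Integration.integral_combine integrable_continuous_real continuous_on_subset[OF assms(1)]) auto
    then have "integral {x - h..x} f = - (integral {a..x - h} f - integral {a..x} f)" by (simp add: algebra_simps)
    then show ?case by (simp add: scaleR_diff_right)
  qed
  ultimately show ?thesis using Lim_transform_eventually by fastforce
qed

text \<open>Since \<open>A\<close> is linear, \<open>z\<close> may be rescaled to norm one and
  compared with 0. There the Lipschitz constant on the unit ball controls \<open>f\<close>, so
  dissipativity of the nonlinear sum turns into an estimate for \<open>A\<close> alone.\<close>

lemma dissipative_Lipschitz_perturbation:
  assumes A: "linear_operator D A" and d: "dissipative_on D (\<lambda>y. A y + f y - \<zeta> *\<^sub>R y)"
    and f: "L-lipschitz_on (cball 0 1) f" and z: "z \<in> D" and \<alpha>: "0 < \<alpha>"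
  shows "(1 - \<alpha> * (L + \<bar>\<zeta>\<bar>)) * norm z \<le> norm (z - \<alpha> *\<^sub>R A z)"
proof (cases "z = 0")
  case False
  define h where "h = 1 / norm z"
  have h: "0 < h" "norm (h *\<^sub>R z) = 1" using False by (auto simp: h_def)
  have D: "0 \<in> D" "h *\<^sub>R z \<in> D" and lin: "A (h *\<^sub>R z) = h *\<^sub>R A z" "A 0 = 0"
    using A z by (auto simp: linear_operator_def subspace_0 subspace_scale)
      (metis scaleR_zero_left subspace_0)
  have "norm (f (h *\<^sub>R z) - f 0) \<le> L"
    using lipschitz_onD[OF f, of "h *\<^sub>R z" 0] h by (simp add: dist_norm)
  then have 1: "norm (\<alpha> *\<^sub>R (f (h *\<^sub>R z) - f 0)) \<le> \<alpha> * L" using \<alpha> by simp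
  have 2: "norm ((\<alpha> * \<zeta> * h) *\<^sub>R z) = \<alpha> * \<bar>\<zeta>\<bar>" using h \<alpha> by (simp add: abs_mult)
  have "1 \<le> norm (h *\<^sub>R z - 0 - \<alpha> *\<^sub>R ((A (h *\<^sub>R z) + f (h *\<^sub>R z) - \<zeta> *\<^sub>R (h *\<^sub>R z)) - (A 0 + f 0 - \<zeta> *\<^sub>R 0)))"
    using d D \<alpha> h(2) unfolding dissipative_on_def by (metis diff_zero)
  also have "\<dots> = norm (h *\<^sub>R (z - \<alpha> *\<^sub>R A z) - \<alpha> *\<^sub>R (f (h *\<^sub>R z) - f 0) + (\<alpha> * \<zeta> * h) *\<^sub>R z)"
    by (simp add: lin algebra_simps)
  also have "\<dots> \<le> norm (h *\<^sub>R (z - \<alpha> *\<^sub>R A z)) + norm (\<alpha> *\<^sub>R (f (h *\<^sub>R z) - f 0)) + norm ((\<alpha> * \<zeta> * h) *\<^sub>R z)"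
    by (intro norm_triangle_le add_mono norm_triangle_ineq4 order_refl)
  also have "\<dots> \<le> h * norm (z - \<alpha> *\<^sub>R A z) + \<alpha> * L + \<alpha> * \<bar>\<zeta>\<bar>"
    using 1 2 h by simp
  finally have "1 - \<alpha> * (L + \<bar>\<zeta>\<bar>) \<le> h * norm (z - \<alpha> *\<^sub>R A z)" by (simp add: algebra_simps)
  then show ?thesis using False by (simp add: h_def field_simps)
qed simp

text \<open>For linear \<open>A\<close> this expresses dissipativity of A - \<omega> I, with the
  shift moved to the smaller side; the inequality is trivial once \<alpha> * \<omega> \<ge>
  1.\<close>

definition quasi_dissipative :: "real \<Rightarrow> 'a::real_normed_vector set \<Rightarrow> ('a \<Rightarrow> 'a) \<Rightarrow> bool" where
  "quasi_dissipative \<omega> D A \<longleftrightarrow> (\<forall>z\<in>D. \<forall>\<alpha>>0. (1 - \<alpha> * \<omega>) * norm z \<le> norm (z - \<alpha> *\<^sub>R A z))"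

text \<open>The choice \<alpha> = 1 / \<mu> turns \<open>z - \<alpha> *\<^sub>R A z\<close> at
  \<open>z = R v\<close> into \<open>v\<close> divided by \<mu>.\<close>

lemma quasi_dissipative_resolvent_bound:
  assumes "quasi_dissipative \<omega> D A" and R: "real_resolvent D A \<mu> R" and \<mu>: "0 < \<mu>" "\<omega> < \<mu>"
  shows "norm (R v) \<le> norm v / (\<mu> - \<omega>)"
proof -
  have Rv: "R v \<in> D" "\<mu> *\<^sub>R R v - A (R v) = v" using R by (auto simp: real_resolvent_def)
  have "(1 - 1 / \<mu> * \<omega>) * norm (R v) \<le> norm (R v - (1 / \<mu>) *\<^sub>R A (R v))"
  proof -
    have "0 < 1 / \<mu>" using \<mu> by simp
    then show ?thesis using assms(1) Rv(1) unfolding quasi_dissipative_def by blast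
  qed
  also have "R v - (1 / \<mu>) *\<^sub>R A (R v) = (1 / \<mu>) *\<^sub>R (\<mu> *\<^sub>R R v - A (R v))"
    using \<mu> by (simp add: algebra_simps)
  also have "norm \<dots> = norm v / \<mu>" using Rv \<mu> by simp
  finally have "\<mu> * ((1 - 1 / \<mu> * \<omega>) * norm (R v)) \<le> \<mu> * (norm v / \<mu>)"
    using \<mu> by (intro mult_left_mono) auto
  moreover have "\<mu> * ((1 - 1 / \<mu> * \<omega>) * norm (R v)) = (\<mu> - \<omega>) * norm (R v)"
    using \<mu> by (simp add: right_diff_distrib mult.assoc[symmetric])
  moreover have "\<mu> * (norm v / \<mu>) = norm v" using \<mu> by simp
  ultimately have "(\<mu> - \<omega>) * norm (R v) \<le> norm v" by (simp only:)
  then show ?thesis using \<mu> by (simp add: field_simps)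
qed

text \<open>The maximum of \<open>exp (- \<kappa> * t) * norm (u t)\<close> is attained at some \<open>t\<^sub>0 > 0\<close>; there the left
  difference quotient of \<open>u\<close>, tested against quasi-dissipativity, bounds \<open>norm (u t\<^sub>0)\<close> by the
  forcing term.\<close>

lemma quasi_dissipative_evolution_bound:
  fixes u :: "real \<Rightarrow> 'a::real_normed_vector"
  assumes A: "quasi_dissipative \<omega> D A" and \<kappa>: "0 \<le> \<kappa>" "\<omega> < \<kappa>"
    and u: "continuous_on {0<..T} u" "\<And>t. t \<in> {0<..T} \<Longrightarrow> u t \<in> D"
      "\<And>t. t \<in> {0<..T} \<Longrightarrow> norm (u t) \<le> B * t"
    and u': "\<And>t. t \<in> {0<..T} \<Longrightarrow> ((\<lambda>h. (u t - u (t - h)) /\<^sub>R h) \<longlongrightarrow> A (u t) + g t) (at_right 0)"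
    and g: "\<And>t. t \<in> {0<..T} \<Longrightarrow> norm (g t) \<le> G * exp (\<kappa> * t)"
    and t1: "t1 \<in> {0<..T}"
  shows "norm (u t1) \<le> G / (\<kappa> - \<omega>) * exp (\<kappa> * t1)"
proof (cases "u t1 = 0")
  case True
  have "0 \<le> G * exp (\<kappa> * t1)" using g[OF t1] norm_ge_zero order_trans by blast
  then show ?thesis using True \<kappa> by (simp add: zero_le_mult_iff)
next
  case False
  define \<theta> where "\<theta> t = exp (- \<kappa> * t) * norm (u t)" for t
  have \<theta>1: "0 < \<theta> t1" using False by (simp add: \<theta>_def)
  have B: "0 \<le> B"
    using order_trans[OF norm_ge_zero u(3)[OF t1]] t1 by (auto simp: zero_le_mult_iff)
  \<comment> \<open>Since \<open>u\<close> is controlled only on the half-open interval, compactness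
    is regained by cutting at \<open>r\<close>: to the left of \<open>r\<close> the bound
    \<open>B * t\<close> keeps \<theta> below its value at \<open>t1\<close>.\<close>
  define r where "r = min t1 (\<theta> t1 / (B + 1))"
  have r: "0 < r" "r \<le> t1" using t1 \<theta>1 B by (auto simp: r_def)
  have "continuous_on {r..T} \<theta>"
    unfolding \<theta>_def using r by (intro continuous_intros continuous_on_subset[OF u(1)]) auto
  moreover have "{r..T} \<noteq> {}" using r t1 by auto
  ultimately obtain t0 where t0: "t0 \<in> {r..T}" "\<And>t. t \<in> {r..T} \<Longrightarrow> \<theta> t \<le> \<theta> t0"
    using continuous_attains_sup[of "{r..T}" \<theta>] by auto
  have t0': "t0 \<in> {0<..T}" using t0 r by auto
  have max: "\<theta> t \<le> \<theta> t0" if "t \<in> {0<..T}" for t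
  proof (cases "r \<le> t")
    case True
    then show ?thesis using t0(2) that by simp
  next
    case False
    have "\<theta> t \<le> 1 * norm (u t)"
      unfolding \<theta>_def using that \<kappa> by (intro mult_right_mono) auto
    also have "\<dots> \<le> B * t" using u(3) that by simp
    also have "\<dots> \<le> B * (\<theta> t1 / (B + 1))" using False B by (intro mult_left_mono) (auto simp: r_def)
    also have "\<dots> \<le> \<theta> t1" using B \<theta>1 by (simp add: field_simps)
    also have "\<dots> \<le> \<theta> t0" using t0(2) r t1 by simp
    finally show ?thesis .
  qed
  \<comment> \<open>The left difference quotient with \<open>A (u t0)\<close> removed; it tends to
    the forcing term at \<open>t0\<close>.\<close>
  define w where "w h = (u t0 - u (t0 - h)) /\<^sub>R h - A (u t0)" for h
  have "(w \<longlongrightarrow> g t0) (at_right 0)"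
    unfolding w_def using tendsto_diff[OF u'[OF t0'] tendsto_const[of "A (u t0)"]] by simp
  then have lim_r: "((\<lambda>h. norm (w h)) \<longlongrightarrow> norm (g t0)) (at_right 0)" by (rule tendsto_norm)
  have "((\<lambda>h. exp (- \<kappa> * h)) has_vector_derivative - \<kappa>) (at 0 within UNIV)"
    by (auto intro!: derivative_eq_intros simp flip: has_real_derivative_iff_has_vector_derivative)
  from has_vector_derivative_quotient[OF this, of 1]
  have "((\<lambda>h. (exp (- \<kappa> * h) - 1) / h) \<longlongrightarrow> - \<kappa>) (at_right 0)"
    by (simp add: divide_inverse mult.commute)
  then have lim_l: "((\<lambda>h. (- ((exp (- \<kappa> * h) - 1) / h) - \<omega>) * norm (u t0)) \<longlongrightarrow> (- (- \<kappa>) - \<omega>) * norm (u t0)) (at_right 0)"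
    by (intro tendsto_intros)
  have "(- (- \<kappa>) - \<omega>) * norm (u t0) \<le> norm (g t0)"
  proof (rule tendsto_le[OF _ lim_r lim_l])
    have "\<forall>\<^sub>F h in at_right 0. h \<in> {0<..<t0}" using t0' by (intro eventually_at_right_real) simp
    then show "\<forall>\<^sub>F h in at_right 0. (- ((exp (- \<kappa> * h) - 1) / h) - \<omega>) * norm (u t0) \<le> norm (w h)"
    proof eventually_elim
      case (elim h)
      then have h: "0 < h" and th: "t0 - h \<in> {0<..T}" using t0' by auto
      \<comment> \<open>Maximality at \<open>t0\<close> says that \<open>norm (u (t0 - h))\<close>
        is at most \<open>exp (- \<kappa> * h) * norm (u t0)\<close>; this competes with the lower
        bound from quasi-dissipativity with step \<open>h\<close>.\<close>
      have "exp (- \<kappa> * (t0 - h)) * norm (u (t0 - h)) \<le> exp (- \<kappa> * t0) * norm (u t0)"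
        using max[OF th] by (simp add: \<theta>_def)
      then have "exp (\<kappa> * (t0 - h)) * (exp (- \<kappa> * (t0 - h)) * norm (u (t0 - h)))
          \<le> exp (\<kappa> * (t0 - h)) * (exp (- \<kappa> * t0) * norm (u t0))"
        by (rule mult_left_mono) simp
      then have le1: "norm (u (t0 - h)) \<le> exp (- \<kappa> * h) * norm (u t0)"
        by (simp only: mult.assoc[symmetric] exp_add[symmetric]) (simp add: right_diff_distrib)
      have "(1 - h * \<omega>) * norm (u t0) \<le> norm (u t0 - h *\<^sub>R A (u t0))"
        using A u(2)[OF t0'] h unfolding quasi_dissipative_def by blast
      also have "u t0 - h *\<^sub>R A (u t0) = u (t0 - h) + h *\<^sub>R w h"
        using h by (simp add: w_def algebra_simps)
      also have "norm \<dots> \<le> norm (u (t0 - h)) + h * norm (w h)"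
        using h norm_triangle_ineq[of "u (t0 - h)" "h *\<^sub>R w h"] by simp
      finally have "(1 - h * \<omega> - exp (- \<kappa> * h)) * norm (u t0) \<le> h * norm (w h)"
        using le1 by (simp add: algebra_simps)
      moreover have "(1 - h * \<omega> - exp (- \<kappa> * h)) * norm (u t0) = h * ((- ((exp (- \<kappa> * h) - 1) / h) - \<omega>) * norm (u t0))"
        using h by (simp add: field_simps)
      ultimately have "h * ((- ((exp (- \<kappa> * h) - 1) / h) - \<omega>) * norm (u t0)) \<le> h * norm (w h)" by metis
      then show ?case using h by (simp only: mult_le_cancel_left_pos)
    qed
  qed simp
  then have "(\<kappa> - \<omega>) * norm (u t0) \<le> G * exp (\<kappa> * t0)" using g[OF t0'] by simp
  then have "norm (u t0) \<le> G / (\<kappa> - \<omega>) * exp (\<kappa> * t0)" using \<kappa> by (simp add: field_simps)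
  then have "\<theta> t0 \<le> exp (- \<kappa> * t0) * (G / (\<kappa> - \<omega>) * exp (\<kappa> * t0))"
    unfolding \<theta>_def by (rule mult_left_mono) simp
  also have "\<dots> = G / (\<kappa> - \<omega>)" by (simp add: exp_minus field_simps)
  finally have "\<theta> t1 \<le> G / (\<kappa> - \<omega>)" using max[OF t1] by simp
  then have "exp (\<kappa> * t1) * \<theta> t1 \<le> exp (\<kappa> * t1) * (G / (\<kappa> - \<omega>))" by (rule mult_left_mono) simp
  moreover have "exp (\<kappa> * t1) * \<theta> t1 = norm (u t1)"
    unfolding \<theta>_def by (simp only: mult.assoc[symmetric] exp_add[symmetric]) simp
  ultimately show ?thesis by (simp add: mult.commute)
qed

text \<open>On the closure of the domain, which need not be the whole space,
  \<open>\<mu> *\<^sub>R R \<mu> v\<close> recovers \<open>v\<close> in the limit, so a bound on the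
  regularizations passes to \<open>v\<close>.\<close>

lemma quasi_dissipative_closure_bound:
  assumes A: "quasi_dissipative \<omega> D A"
    and R: "\<forall>\<^sub>F \<mu> in at_top. real_resolvent D A \<mu> (R \<mu>)"
    and v: "v \<in> closure D" and c: "\<forall>\<^sub>F \<mu> in at_top. norm (\<mu> *\<^sub>R R \<mu> v) \<le> c \<mu>" and lim: "(c \<longlongrightarrow> C) at_top"
  shows "norm v \<le> C"
proof (rule field_le_epsilon)
  fix e :: real assume e: "0 < e"
  obtain w where w: "w \<in> D" "dist w v < e / 2" using v e by (metis closure_approachable half_gt_zero)
  have "norm v \<le> C + 2 * (e / 2)"
  proof (rule tendsto_lowerbound)
    have k: "((\<lambda>\<mu>. 1 / (\<mu> - \<omega>)) \<longlongrightarrow> 0) at_top"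
      by (intro tendsto_divide_0[OF tendsto_const] filterlim_at_top_imp_at_infinity)
        (simp add: filterlim_tendsto_add_at_top[OF tendsto_const filterlim_ident, of "- \<omega>", simplified])
    have "((\<lambda>\<mu>. c \<mu> + (e / 2 + (1 + \<omega> * (1 / (\<mu> - \<omega>))) * (e / 2) + norm (A w) * (1 / (\<mu> - \<omega>)))) \<longlongrightarrow>
        C + (e / 2 + (1 + \<omega> * 0) * (e / 2) + norm (A w) * 0)) at_top"
      by (intro tendsto_intros lim k)
    then show "((\<lambda>\<mu>. c \<mu> + (e / 2 + (1 + \<omega> * (1 / (\<mu> - \<omega>))) * (e / 2) + norm (A w) * (1 / (\<mu> - \<omega>)))) \<longlongrightarrow> C + 2 * (e / 2)) at_top"
      by simp
    show "\<forall>\<^sub>F \<mu> in at_top. norm v \<le> c \<mu> + (e / 2 + (1 + \<omega> * (1 / (\<mu> - \<omega>))) * (e / 2) + norm (A w) * (1 / (\<mu> - \<omega>)))"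
      using R c eventually_gt_at_top[of "max 0 \<omega>"]
    proof eventually_elim
      case (elim \<mu>)
      then have \<mu>: "0 < \<mu>" "\<omega> < \<mu>" by auto
      interpret R: bounded_linear "R \<mu>" using elim by (simp add: real_resolvent_def)
      have bd: "norm (R \<mu> x) \<le> norm x / (\<mu> - \<omega>)" for x
        using A elim(1) \<mu> by (rule quasi_dissipative_resolvent_bound)
      \<comment> \<open>A nearby domain element \<open>w\<close> is written through the resolvent.
        The errors \<open>v - w\<close> and \<open>\<mu> *\<^sub>R R \<mu> (w - v)\<close> are of
        order \<open>e\<close>, and \<open>R \<mu> (A w)\<close> vanishes as \<mu> grows.\<close>
      have "R \<mu> (\<mu> *\<^sub>R w - A w) = w" using elim w by (simp add: real_resolvent_def)
      then have "v = (v - w) + (\<mu> *\<^sub>R R \<mu> v + \<mu> *\<^sub>R R \<mu> (w - v)) - R \<mu> (A w)"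
        by (simp add: R.diff R.scaleR algebra_simps)
      also have "norm \<dots> \<le> norm (v - w) + (norm (\<mu> *\<^sub>R R \<mu> v) + norm (\<mu> *\<^sub>R R \<mu> (w - v))) + norm (R \<mu> (A w))"
        by (intro norm_triangle_le norm_triangle_le_diff add_mono norm_triangle_ineq order_refl)
      also have "\<dots> \<le> e / 2 + (c \<mu> + \<mu> * ((e / 2) / (\<mu> - \<omega>))) + norm (A w) / (\<mu> - \<omega>)"
      proof (intro add_mono bd)
        show "norm (v - w) \<le> e / 2" using w by (simp add: dist_norm norm_minus_commute)
        have "norm (R \<mu> (w - v)) \<le> (e / 2) / (\<mu> - \<omega>)"
          using w \<mu> by (intro order_trans[OF bd] divide_right_mono) (auto simp: dist_norm)
        then have "\<mu> * norm (R \<mu> (w - v)) \<le> \<mu> * ((e / 2) / (\<mu> - \<omega>))" using \<mu> by (intro mult_left_mono) auto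
        then show "norm (\<mu> *\<^sub>R R \<mu> (w - v)) \<le> \<mu> * ((e / 2) / (\<mu> - \<omega>))" using \<mu> by simp
      qed (use elim in simp)
      also have "\<mu> * ((e / 2) / (\<mu> - \<omega>)) = (1 + \<omega> * (1 / (\<mu> - \<omega>))) * (e / 2)"
        using \<mu> by (simp add: field_simps)
      finally show ?case by simp
    qed
  qed simp
  then show "norm v \<le> C + e" by simp
qed

section \<open>Convolutions taking values in the embedded space\<close>

lemma set_integral_singleton:
  fixes f :: "real \<Rightarrow> 'a::{banach, second_countable_topology}"
  shows "(LINT s:{a}|lborel. f s) = 0"
  unfolding set_lebesgue_integral_def
  by (rule integral_eq_zero_AE, rule eventually_mono[OF AE_lborel_singleton[of a]]) auto

lemma real_resolvent_generator:
  assumes "real_resolvent D A \<mu> R"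
  shows "A (R y) = \<mu> *\<^sub>R R y - y"
proof -
  have "\<mu> *\<^sub>R R y - A (R y) = y" using assms by (simp add: real_resolvent_def)
  then show ?thesis by (metis diff_diff_eq2 add_diff_cancel_left')
qed

text \<open>Integrals in the larger space are Bochner integrals; those in \<open>'e\<close>, which
  carries no countability assumption, are gauge integrals of continuous functions.\<close>

locale embedded_generator =
  fixes D :: "'x::{banach, second_countable_topology} set" and A S
    and j :: "'e::banach \<Rightarrow> 'x"
  assumes gen: "generates_C0_semigroup D A S"
    and sect: "sectorial D A" "sectorial (part_dom j D A) (part_map j A)"
    and bl_j: "bounded_linear j" and inj_j: "inj j"
begin

abbreviation "domE \<equiv> part_dom j D A"
abbreviation "genE \<equiv> part_map j A"
abbreviation "resE \<equiv> resolvent domE genE"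

sublocale j: bounded_linear j by (rule bl_j)

lemma C0: "C0_semigroup S"
  using gen by (rule generates_C0_semigroupD)

lemma part_dom_D: "e \<in> domE \<Longrightarrow> j e \<in> D \<and> j (genE e) = A (j e)"
  by (auto simp: part_dom_def part_map_def f_inv_into_f)

text \<open>Applying \<open>j\<close> to the resolvent equation of the part gives the resolvent
  equation of \<open>A\<close> with right-hand side \<open>j v\<close>, whose solution is
  unique.\<close>

lemma part_resolvent:
  assumes R: "real_resolvent D A \<mu> R" and Q: "real_resolvent domE genE \<mu> Q"
  shows "j (Q v) = R (j v)"
proof -
  have "Q v \<in> domE" and v: "\<mu> *\<^sub>R Q v - genE (Q v) = v" using Q by (auto simp: real_resolvent_def)
  then have q: "j (Q v) \<in> D" "j (genE (Q v)) = A (j (Q v))" using part_dom_D by auto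
  have "j v = \<mu> *\<^sub>R j (Q v) - A (j (Q v))"
    by (subst (1) v[symmetric]) (simp add: j.diff j.scaleR q)
  then show ?thesis using R q unfolding real_resolvent_def by simp
qed

lemma eventually_real_resolvent:
  "\<forall>\<^sub>F \<mu> in at_top. real_resolvent D A \<mu> (resolvent D A \<mu>) \<and> real_resolvent domE genE \<mu> (resE \<mu>)"
proof -
  obtain \<omega> where "\<And>\<mu>. \<omega> < \<mu> \<Longrightarrow> real_resolvent D A \<mu> (resolvent D A \<mu>)"
    using sectorial_imp_real_resolvent[OF sect(1)] by blast
  moreover obtain \<omega>' where "\<And>\<mu>. \<omega>' < \<mu> \<Longrightarrow> real_resolvent domE genE \<mu> (resE \<mu>)"
    using sectorial_imp_real_resolvent[OF sect(2)] by blast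
  ultimately show ?thesis
    by (intro eventually_mono[OF eventually_gt_at_top[of "max \<omega> \<omega>'"]]) auto
qed

text \<open>The integrand is \<open>genE (Q (d s)) + Q (g s)\<close>, so this is the regularized
  evolution equation in integrated form. It is proved after applying \<open>j\<close>, where the
  right derivative of the convolution is available, and injectivity of \<open>j\<close> brings it
  back to E.\<close>

lemma convolution_in_E:
  fixes d g :: "real \<Rightarrow> 'e"
  assumes R: "real_resolvent D A \<mu> R" and Q: "real_resolvent domE genE \<mu> Q"
    and d: "continuous_on {0<..T} d"
    and g: "continuous_on {0<..T} g" "\<And>t. t \<in> {0<..T} \<Longrightarrow> norm (g t) \<le> L"
    and eq: "\<And>t. t \<in> {0..T} \<Longrightarrow> j (d t) = (LINT s:{0..t}|lborel. S (t - s) (j (g s)))"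
    and rt: "0 < r" "r \<le> t" "t \<le> T"
  shows "Q (d t) - Q (d r) = integral {r..t} (\<lambda>s. \<mu> *\<^sub>R Q (d s) - d s + Q (g s))"
proof -
  interpret Q: bounded_linear Q using Q by (simp add: real_resolvent_def)
  interpret R: bounded_linear R using R by (simp add: real_resolvent_def)
  define f where "f s = \<mu> *\<^sub>R Q (d s) - d s + Q (g s)" for s
  have jQ: "j (Q v) = R (j v)" for v using part_resolvent[OF R Q] .
  have sub: "{r..t} \<subseteq> {0<..T}" using rt by auto
  have f: "continuous_on {r..t} f"
    unfolding f_def
    by (intro continuous_intros Q.continuous_on continuous_on_subset[OF d sub] continuous_on_subset[OF g(1) sub])
  obtain K where K: "\<And>x. norm (j x) \<le> norm x * K" "0 < K" using j.pos_bounded by blast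
  have q: "continuous_on {0<..T} (\<lambda>s. j (g s))" by (intro j.continuous_on g)
  have q_bd: "norm (j (g s)) \<le> L * K" if "s \<in> {0<..T}" for s
    using K g(2)[OF that] by (intro order_trans[OF K(1)] mult_right_mono) auto
  \<comment> \<open>The difference of the two sides in the larger space, up to a constant; its right
    derivative vanishes.\<close>
  define \<psi> where "\<psi> s = R (j (d s)) - j (integral {r..s} f)" for s
  have "\<psi> t = \<psi> r"
  proof (rule zero_right_derivative_imp_eq[OF rt(2)])
    show "continuous_on {r..t} \<psi>"
      unfolding \<psi>_def
      by (intro continuous_intros R.continuous_on j.continuous_on continuous_on_subset[OF d sub]
          indefinite_integral_continuous_1 integrable_continuous_real f)
    fix s assume s: "r \<le> s" "s < t"
    have "((\<lambda>h. (integral {r..s + h} f - integral {r..s} f) /\<^sub>R h) \<longlongrightarrow> f s) (at_right 0)"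
      using f s by (rule integral_right_quotient)
    then have 1: "((\<lambda>h. j ((integral {r..s + h} f - integral {r..s} f) /\<^sub>R h)) \<longlongrightarrow> j (f s)) (at_right 0)"
      by (rule j.tendsto)
    let ?z = "\<lambda>t. LINT s:{0..t}|lborel. S (t - s) (j (g s))"
    have "((\<lambda>h. (R (?z (s + h)) - R (?z s)) /\<^sub>R h) \<longlongrightarrow> A (R (?z s)) + R (j (g s))) (at_right 0)"
      by (rule resolvent_convolution_right_derivative[OF gen R q q_bd]) (use rt s in auto)
    moreover have "\<forall>\<^sub>F h in at_right 0. (R (?z (s + h)) - R (?z s)) /\<^sub>R h = (R (j (d (s + h))) - R (j (d s))) /\<^sub>R h"
      using eventually_at_right_real[of 0 "t - s"]
      by (rule eventually_mono) (use s rt in \<open>auto simp: eq\<close>)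
    ultimately have 2: "((\<lambda>h. (R (j (d (s + h))) - R (j (d s))) /\<^sub>R h) \<longlongrightarrow> A (R (?z s)) + R (j (g s))) (at_right 0)"
      by (rule Lim_transform_eventually)
    have "A (R (?z s)) = \<mu> *\<^sub>R R (?z s) - ?z s"
      by (rule real_resolvent_generator[OF R])
    then have "A (R (?z s)) + R (j (g s)) = j (f s)"
      using s rt by (simp add: f_def j.add j.diff j.scaleR jQ eq)
    then have "A (R (?z s)) + R (j (g s)) - j (f s) = 0" by simp
    moreover have "(R (j (d (s + h))) - R (j (d s))) /\<^sub>R h - j ((integral {r..s + h} f - integral {r..s} f) /\<^sub>R h)
        = (\<psi> (s + h) - \<psi> s) /\<^sub>R h" for h
      by (simp add: \<psi>_def j.diff j.scaleR scaleR_diff_right)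
    ultimately show "((\<lambda>h. (\<psi> (s + h) - \<psi> s) /\<^sub>R h) \<longlongrightarrow> 0) (at_right 0)"
      using tendsto_diff[OF 2 1] by (simp only:)
  qed
  then have "j (Q (d t) - Q (d r)) = j (integral {r..t} f)"
    by (simp add: \<psi>_def jQ j.diff algebra_simps)
  then show ?thesis using injD[OF inj_j] unfolding f_def by blast
qed

text \<open>Solving the integrated equation for the integral of \<open>d\<close> leaves only values
  of the resolvent, so the integral lies in \<open>domE\<close>. Short averages of \<open>d\<close>
  ending at \<open>t\<close> then approximate \<open>d t\<close>.\<close>

lemma convolution_in_closure:
  fixes d g :: "real \<Rightarrow> 'e"
  assumes d: "continuous_on {0<..T} d"
    and g: "continuous_on {0<..T} g" "\<And>t. t \<in> {0<..T} \<Longrightarrow> norm (g t) \<le> L"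
    and eq: "\<And>t. t \<in> {0..T} \<Longrightarrow> j (d t) = (LINT s:{0..t}|lborel. S (t - s) (j (g s)))"
    and t: "t \<in> {0<..T}"
  shows "d t \<in> closure domE"
proof -
  obtain \<mu> R Q where R: "real_resolvent D A \<mu> R" and Q: "real_resolvent domE genE \<mu> Q"
    using eventually_happens[OF eventually_real_resolvent] by auto
  interpret Q: bounded_linear Q using Q by (simp add: real_resolvent_def)
  have QD: "Q v \<in> domE" for v using Q by (simp add: real_resolvent_def)
  have domE: "subspace domE"
    using sectorial_linear_operator[OF sect(2)] by (simp add: linear_operator_def)
  have int: "integral {r..t} d \<in> domE" if r: "0 < r" "r \<le> t" for r
  proof -
    have sub: "{r..t} \<subseteq> {0<..T}" using r t by auto
    have i: "d integrable_on {r..t}" "g integrable_on {r..t}"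
      by (intro integrable_continuous_real continuous_on_subset[OF _ sub] d g)+
    have iQ: "((\<lambda>s. Q (h s)) has_integral Q (integral {r..t} h)) {r..t}" if "h integrable_on {r..t}" for h
      using has_integral_linear[OF integrable_integral[OF that] Q.bounded_linear_axioms] by (simp add: comp_def)
    have "((\<lambda>s. \<mu> *\<^sub>R Q (d s) - d s + Q (g s)) has_integral
        (\<mu> *\<^sub>R Q (integral {r..t} d) - integral {r..t} d + Q (integral {r..t} g))) {r..t}"
      by (intro has_integral_add has_integral_diff has_integral_cmul iQ i integrable_integral)
    then have "Q (d t) - Q (d r) = \<mu> *\<^sub>R Q (integral {r..t} d) - integral {r..t} d + Q (integral {r..t} g)"
      using convolution_in_E[OF R Q d g eq r] t by (simp add: integral_unique)
    then have "integral {r..t} d = \<mu> *\<^sub>R Q (integral {r..t} d) + Q (integral {r..t} g) - (Q (d t) - Q (d r))"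
      by (simp add: algebra_simps)
    also have "\<dots> \<in> domE"
      by (intro subspace_add subspace_diff subspace_scale domE QD)
    finally show ?thesis .
  qed
  show ?thesis
  proof (rule Lim_in_closed_set[OF closed_closure])
    have "continuous_on {t / 2..t} d" using t by (intro continuous_on_subset[OF d]) auto
    then show "((\<lambda>h. integral {t - h..t} d /\<^sub>R h) \<longlongrightarrow> d t) (at_right 0)"
      by (rule integral_left_quotient) (use t in auto)
    have "\<forall>\<^sub>F h in at_right 0. h \<in> {0<..<t}" using t by (intro eventually_at_right_real) auto
    then show "\<forall>\<^sub>F h in at_right 0. integral {t - h..t} d /\<^sub>R h \<in> closure domE"
    proof eventually_elim
      case (elim h)
      then show ?case by (intro subsetD[OF closure_subset] subspace_scale[OF domE] int) auto
    qed
  qed simp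
qed

text \<open>Supplies the linear bound at 0 required by
  \<open>quasi_dissipative_evolution_bound\<close>. The function \<open>Q (d t)\<close> is Lipschitz
  on the half-open interval and so has a limit at 0 in E; continuity of the convolution in the
  larger space identifies this limit as 0.\<close>

lemma resolvent_convolution_vanishes_at_0:
  fixes d g :: "real \<Rightarrow> 'e"
  assumes R: "real_resolvent D A \<mu> R" and Q: "real_resolvent domE genE \<mu> Q"
    and d: "continuous_on {0<..T} d" "\<And>t. t \<in> {0<..T} \<Longrightarrow> norm (d t) \<le> K"
    and g: "continuous_on {0<..T} g" "\<And>t. t \<in> {0<..T} \<Longrightarrow> norm (g t) \<le> L"
    and eq: "\<And>t. t \<in> {0..T} \<Longrightarrow> j (d t) = (LINT s:{0..t}|lborel. S (t - s) (j (g s)))"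
  obtains B where "\<And>t. t \<in> {0<..T} \<Longrightarrow> norm (Q (d t)) \<le> B * t"
proof (cases "0 < T")
  case True
  interpret Q: bounded_linear Q using Q by (simp add: real_resolvent_def)
  interpret R: bounded_linear R using R by (simp add: real_resolvent_def)
  obtain C where C: "\<And>x. norm (Q x) \<le> norm x * C" "0 < C" using Q.pos_bounded by blast
  define f where "f s = \<mu> *\<^sub>R Q (d s) - d s + Q (g s)" for s
  \<comment> \<open>Termwise bound for the integrand \<open>f\<close> of
    \<open>convolution_in_E\<close>; it becomes the Lipschitz constant.\<close>
  define B where "B = \<bar>\<mu>\<bar> * (K * C) + K + L * C"
  have f_bd: "norm (f s) \<le> B" if s: "s \<in> {0<..T}" for s
  proof -
    have "norm (f s) \<le> norm (\<mu> *\<^sub>R Q (d s)) + norm (d s) + norm (Q (g s))"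
      unfolding f_def by (intro norm_triangle_le add_mono norm_triangle_ineq4 order_refl)
    also have "\<dots> \<le> \<bar>\<mu>\<bar> * (K * C) + K + L * C"
      using C(2) d(2)[OF s] g(2)[OF s]
      by (auto intro!: add_mono mult_left_mono order_trans[OF C(1)] mult_right_mono)
    finally show ?thesis by (simp add: B_def)
  qed
  have B: "0 \<le> B" using order_trans[OF norm_ge_zero f_bd[of T]] True by simp
  have le: "norm (Q (d t) - Q (d r)) \<le> B * (t - r)" if "0 < r" "r \<le> t" "t \<le> T" for r t
  proof -
    have sub: "{r..t} \<subseteq> {0<..T}" using that by auto
    have "norm (integral {r..t} f) \<le> B * (t - r)"
    proof (rule integral_bound)
      show "continuous_on {r..t} f"
        unfolding f_def
        by (intro continuous_intros Q.continuous_on continuous_on_subset[OF d(1) sub] continuous_on_subset[OF g(1) sub])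
    qed (use that f_bd in auto)
    then show ?thesis using convolution_in_E[OF R Q d(1) g eq that] by (simp flip: f_def)
  qed
  have "B-lipschitz_on {0<..T} (\<lambda>t. Q (d t))"
  proof (rule lipschitz_onI)
    fix s t assume "s \<in> {0<..T}" "t \<in> {0<..T}"
    then show "dist (Q (d s)) (Q (d t)) \<le> B * dist s t"
      using le[of s t] le[of t s] by (cases "s \<le> t") (auto simp: dist_norm norm_minus_commute)
  qed (rule B)
  then have uc: "uniformly_continuous_on {0<..T} (\<lambda>t. Q (d t))" by (rule lipschitz_on_uniformly_continuous)
  define \<tau> where "\<tau> k = T / real (Suc k)" for k
  have \<tau>: "\<tau> k \<in> {0<..T}" for k using True by (auto simp: \<tau>_def divide_simps)
  have "(\<lambda>k. T * inverse (real (Suc k))) \<longlonglongrightarrow> T * 0"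
    by (intro tendsto_intros LIMSEQ_inverse_real_of_nat)
  then have \<tau>0: "\<tau> \<longlonglongrightarrow> 0" by (simp add: \<tau>_def[abs_def] divide_inverse)
  have "Cauchy (\<lambda>k. Q (d (\<tau> k)))"
    using uc \<tau> by (intro uniformly_continuous_on_Cauchy[OF uc] LIMSEQ_imp_Cauchy[OF \<tau>0])
  then obtain l where l: "(\<lambda>k. Q (d (\<tau> k))) \<longlonglongrightarrow> l" using Cauchy_convergent convergent_def by blast
  obtain K' where K': "\<And>x. norm (j x) \<le> norm x * K'" "0 < K'" using j.pos_bounded by blast
  have "continuous_on {0..T} (\<lambda>t. LINT s:{0..t}|lborel. S (t - s) (j (g s)))"
  proof (rule C0_convolution_continuous_on[OF C0])
    show "continuous_on {0<..T} (\<lambda>s. j (g s))" by (intro j.continuous_on g)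
    show "norm (j (g s)) \<le> L * K'" if "s \<in> {0<..T}" for s
      using K' g(2)[OF that] by (intro order_trans[OF K'(1)] mult_right_mono) auto
  qed
  then have cj: "continuous_on {0..T} (\<lambda>t. j (d t))" by (rule continuous_on_eq) (simp add: eq)
  have "j (d 0) = 0" using eq[of 0] True by (simp add: set_integral_singleton)
  then have "(\<lambda>k. j (d (\<tau> k))) \<longlonglongrightarrow> 0"
    using continuous_on_tendsto_compose[OF cj \<tau>0] \<tau> True by (auto intro: always_eventually less_imp_le)
  then have "(\<lambda>k. R (j (d (\<tau> k)))) \<longlonglongrightarrow> R 0" by (rule R.tendsto)
  moreover have "(\<lambda>k. R (j (d (\<tau> k)))) \<longlonglongrightarrow> j l"
    using j.tendsto[OF l] by (simp add: part_resolvent[OF R Q])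
  ultimately have "j l = j 0" using LIMSEQ_unique by (simp add: R.zero j.zero) blast
  then have l0: "l = 0" by (rule injD[OF inj_j])
  \<comment> \<open>The Lipschitz estimate between \<open>t\<close> and \<open>\<tau> k\<close> is
    passed to the limit, where the second point contributes \<open>l = 0\<close>.\<close>
  show ?thesis
  proof
    fix t assume t: "t \<in> {0<..T}"
    have "norm (Q (d t) - l) \<le> B * (t - 0)"
    proof (rule tendsto_le[OF sequentially_bot])
      show "(\<lambda>k. B * (t - \<tau> k)) \<longlonglongrightarrow> B * (t - 0)" by (intro tendsto_intros \<tau>0)
      show "(\<lambda>k. norm (Q (d t) - Q (d (\<tau> k)))) \<longlonglongrightarrow> norm (Q (d t) - l)" by (intro tendsto_intros l)
      have "\<forall>\<^sub>F k in sequentially. \<tau> k < t" using \<tau>0 t by (intro order_tendstoD) auto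
      then show "\<forall>\<^sub>F k in sequentially. norm (Q (d t) - Q (d (\<tau> k))) \<le> B * (t - \<tau> k)"
        by eventually_elim (use le \<tau> t in auto)
    qed
    then show "norm (Q (d t)) \<le> B * t" by (simp add: l0)
  qed
qed (use that in auto)

text \<open>For each large \<mu> the evolution bound is applied to \<open>resE \<mu> (d t)\<close>,
  whose forcing \<open>resE \<mu> (g t)\<close> gains the factor 1 / (\<mu> - \<omega>) from the
  resolvent bound. After multiplication by \<mu> the constants converge, because \<mu> / (\<mu> -
  \<omega>) tends to 1.\<close>

lemma convolution_exp_bound:
  fixes d g :: "real \<Rightarrow> 'e"
  assumes A: "quasi_dissipative \<omega> domE genE" and \<kappa>: "0 \<le> \<kappa>" "\<omega> < \<kappa>"
    and d: "continuous_on {0<..T} d" "\<And>t. t \<in> {0<..T} \<Longrightarrow> norm (d t) \<le> K"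
    and g: "continuous_on {0<..T} g" "\<And>t. t \<in> {0<..T} \<Longrightarrow> norm (g t) \<le> L"
    and eq: "\<And>t. t \<in> {0..T} \<Longrightarrow> j (d t) = (LINT s:{0..t}|lborel. S (t - s) (j (g s)))"
    and g_exp: "\<And>t. t \<in> {0<..T} \<Longrightarrow> norm (g t) \<le> G * exp (\<kappa> * t)"
    and t: "t \<in> {0<..T}"
  shows "norm (d t) \<le> G / (\<kappa> - \<omega>) * exp (\<kappa> * t)"
proof (rule quasi_dissipative_closure_bound[OF A])
  show "\<forall>\<^sub>F \<mu> in at_top. real_resolvent domE genE \<mu> (resE \<mu>)"
    using eventually_real_resolvent by eventually_elim simp
  show "d t \<in> closure domE" by (rule convolution_in_closure[OF d(1) g eq t])
  have k: "((\<lambda>\<mu>. 1 / (\<mu> - \<omega>)) \<longlongrightarrow> 0) at_top"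
    by (intro tendsto_divide_0[OF tendsto_const] filterlim_at_top_imp_at_infinity)
      (simp add: filterlim_tendsto_add_at_top[OF tendsto_const filterlim_ident, of "- \<omega>", simplified])
  have "((\<lambda>\<mu>. (1 + \<omega> * (1 / (\<mu> - \<omega>))) * (G / (\<kappa> - \<omega>) * exp (\<kappa> * t)))
      \<longlongrightarrow> (1 + \<omega> * 0) * (G / (\<kappa> - \<omega>) * exp (\<kappa> * t))) at_top"
    by (intro tendsto_intros k)
  then show "((\<lambda>\<mu>. (1 + \<omega> * (1 / (\<mu> - \<omega>))) * (G / (\<kappa> - \<omega>) * exp (\<kappa> * t)))
      \<longlongrightarrow> G / (\<kappa> - \<omega>) * exp (\<kappa> * t)) at_top" by simp
  show "\<forall>\<^sub>F \<mu> in at_top. norm (\<mu> *\<^sub>R resE \<mu> (d t)) \<le> (1 + \<omega> * (1 / (\<mu> - \<omega>))) * (G / (\<kappa> - \<omega>) * exp (\<kappa> * t))"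
    using eventually_real_resolvent eventually_gt_at_top[of "max 0 \<omega>"]
  proof eventually_elim
    case (elim \<mu>)
    then have R: "real_resolvent D A \<mu> (resolvent D A \<mu>)" and Q: "real_resolvent domE genE \<mu> (resE \<mu>)"
      and \<mu>: "0 < \<mu>" "\<omega> < \<mu>" by auto
    interpret Q: bounded_linear "resE \<mu>" using Q by (simp add: real_resolvent_def)
    obtain B where B: "\<And>t. t \<in> {0<..T} \<Longrightarrow> norm (resE \<mu> (d t)) \<le> B * t"
      using resolvent_convolution_vanishes_at_0[OF R Q d g eq] by blast
    have "norm (resE \<mu> (d t)) \<le> (G / (\<mu> - \<omega>)) / (\<kappa> - \<omega>) * exp (\<kappa> * t)"
    proof (rule quasi_dissipative_evolution_bound[OF A \<kappa> _ _ B _ _ t])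
      show "continuous_on {0<..T} (\<lambda>t. resE \<mu> (d t))" by (intro Q.continuous_on d)
      show "resE \<mu> (d s) \<in> domE" for s using Q by (simp add: real_resolvent_def)
      show "norm (resE \<mu> (g s)) \<le> G / (\<mu> - \<omega>) * exp (\<kappa> * s)" if "s \<in> {0<..T}" for s
      proof -
        have "norm (resE \<mu> (g s)) \<le> norm (g s) / (\<mu> - \<omega>)"
          using A Q \<mu> by (rule quasi_dissipative_resolvent_bound)
        also have "\<dots> \<le> G * exp (\<kappa> * s) / (\<mu> - \<omega>)"
          using g_exp[OF that] \<mu> by (intro divide_right_mono) auto
        finally show ?thesis by simp
      qed
      fix s assume s: "s \<in> {0<..T}"
      let ?f = "\<lambda>s. \<mu> *\<^sub>R resE \<mu> (d s) - d s + resE \<mu> (g s)"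
      \<comment> \<open>Only times near \<open>s\<close> matter for the left quotient, and this
        interval avoids 0, where \<open>d\<close> and \<open>g\<close> may be discontinuous.\<close>
      have sub: "{s / 2..s} \<subseteq> {0<..T}" using s by auto
      have "continuous_on {s / 2..s} ?f"
        by (intro continuous_intros Q.continuous_on continuous_on_subset[OF d(1) sub] continuous_on_subset[OF g(1) sub])
      then have "((\<lambda>h. integral {s - h..s} ?f /\<^sub>R h) \<longlongrightarrow> ?f s) (at_right 0)"
        by (rule integral_left_quotient) (use s in auto)
      moreover have "\<forall>\<^sub>F h in at_right 0. integral {s - h..s} ?f /\<^sub>R h = (resE \<mu> (d s) - resE \<mu> (d (s - h))) /\<^sub>R h"
      proof -
        have "\<forall>\<^sub>F h in at_right 0. h \<in> {0<..<s}" using s by (intro eventually_at_right_real) auto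
        then show ?thesis
        proof eventually_elim
          case (elim h)
          then show ?case using s by (subst convolution_in_E[OF R Q d(1) g eq]) auto
        qed
      qed
      ultimately have "((\<lambda>h. (resE \<mu> (d s) - resE \<mu> (d (s - h))) /\<^sub>R h) \<longlongrightarrow> ?f s) (at_right 0)"
        by (rule Lim_transform_eventually)
      moreover have "genE (resE \<mu> (d s)) = \<mu> *\<^sub>R resE \<mu> (d s) - d s"
        by (rule real_resolvent_generator[OF Q])
      ultimately show "((\<lambda>h. (resE \<mu> (d s) - resE \<mu> (d (s - h))) /\<^sub>R h) \<longlongrightarrow> genE (resE \<mu> (d s)) + resE \<mu> (g s)) (at_right 0)"
        by simp
    qed
    then have "\<mu> * norm (resE \<mu> (d t)) \<le> \<mu> * ((G / (\<mu> - \<omega>)) / (\<kappa> - \<omega>) * exp (\<kappa> * t))"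
      using \<mu> by (intro mult_left_mono) auto
    also have "\<dots> = \<mu> / (\<mu> - \<omega>) * (G / (\<kappa> - \<omega>) * exp (\<kappa> * t))" by simp
    also have "\<mu> / (\<mu> - \<omega>) = 1 + \<omega> * (1 / (\<mu> - \<omega>))" using \<mu> by (simp add: field_simps)
    finally show ?case using \<mu> by simp
  qed
qed

text \<open>A contraction in an exponentially weighted supremum norm, which is finite because
  \<open>d\<close> is bounded: \<open>convolution_exp_bound\<close> shows that the norm is at most
  half of itself.\<close>

lemma convolution_Lipschitz_imp_zero:
  fixes d g :: "real \<Rightarrow> 'e"
  assumes A: "quasi_dissipative \<omega> domE genE"
    and d: "continuous_on {0<..T} d" "\<And>t. t \<in> {0<..T} \<Longrightarrow> norm (d t) \<le> K"
    and g: "continuous_on {0<..T} g" "\<And>t. t \<in> {0<..T} \<Longrightarrow> norm (g t) \<le> L * norm (d t)"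
    and L: "0 \<le> L"
    and eq: "\<And>t. t \<in> {0..T} \<Longrightarrow> j (d t) = (LINT s:{0..t}|lborel. S (t - s) (j (g s)))"
    and t: "t \<in> {0<..T}"
  shows "d t = 0"
proof -
  \<comment> \<open>Chosen so that \<open>L / (\<kappa> - \<omega>)\<close> is at most 1/2 and
    \<kappa> exceeds \<omega> even when \<open>L = 0\<close>.\<close>
  define \<kappa> where "\<kappa> = \<bar>\<omega>\<bar> + 2 * L + 1"
  have \<kappa>: "0 \<le> \<kappa>" "\<omega> < \<kappa>" "2 * L \<le> \<kappa> - \<omega>" using L by (auto simp: \<kappa>_def)
  define \<theta> where "\<theta> s = exp (- \<kappa> * s) * norm (d s)" for s
  define \<sigma> where "\<sigma> = (SUP s\<in>{0<..T}. \<theta> s)"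
  have "\<theta> s \<le> 1 * K" if "s \<in> {0<..T}" for s
    unfolding \<theta>_def using d(2)[OF that] that \<kappa> by (intro mult_mono) auto
  then have "bdd_above (\<theta> ` {0<..T})" by (rule bdd_aboveI2)
  then have le: "\<theta> s \<le> \<sigma>" if "s \<in> {0<..T}" for s
    unfolding \<sigma>_def using that by (rule cSUP_upper2[where x = s]) auto
  have dle: "norm (d s) \<le> \<sigma> * exp (\<kappa> * s)" if "s \<in> {0<..T}" for s
  proof -
    have "exp (\<kappa> * s) * \<theta> s = norm (d s)"
      unfolding \<theta>_def by (simp only: mult.assoc[symmetric] exp_add[symmetric]) simp
    then show ?thesis using mult_left_mono[OF le[OF that], of "exp (\<kappa> * s)"] by (simp add: mult.commute)
  qed
  have gK: "norm (g s) \<le> L * K" if "s \<in> {0<..T}" for s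
    using d(2)[OF that] L by (intro order_trans[OF g(2)[OF that]] mult_left_mono)
  have \<sigma>: "0 \<le> \<sigma>" using le[OF t] by (auto simp: \<theta>_def intro: order_trans[rotated])
  have "\<theta> s \<le> \<sigma> / 2" if s: "s \<in> {0<..T}" for s
  proof -
    have "norm (d s) \<le> L * \<sigma> / (\<kappa> - \<omega>) * exp (\<kappa> * s)"
    proof (rule convolution_exp_bound[OF A \<kappa>(1,2) d g(1) gK eq _ s])
      show "norm (g s) \<le> L * \<sigma> * exp (\<kappa> * s)" if "s \<in> {0<..T}" for s
        using mult_left_mono[OF dle[OF that] L] g(2)[OF that] by (simp add: mult.assoc)
    qed
    also have "L * \<sigma> / (\<kappa> - \<omega>) \<le> \<sigma> / 2"
      using mult_right_mono[OF \<kappa>(3) \<sigma>] \<kappa>(2) by (simp add: field_simps)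
    finally have "norm (d s) \<le> \<sigma> / 2 * exp (\<kappa> * s)" by simp
    then have "\<theta> s \<le> exp (- \<kappa> * s) * (\<sigma> / 2 * exp (\<kappa> * s))"
      unfolding \<theta>_def by (rule mult_left_mono) simp
    also have "\<dots> = \<sigma> / 2" by (simp add: exp_minus field_simps)
    finally show ?thesis .
  qed
  then have "\<sigma> \<le> \<sigma> / 2" unfolding \<sigma>_def using t by (intro cSUP_least) auto
  then have "\<sigma> = 0" using \<sigma> by simp
  then show ?thesis using dle[OF t] by simp
qed

end

section \<open>Passage to the limit\<close>

lemma C0_semigroup_tendsto:
  fixes S :: "real \<Rightarrow> 'a::banach \<Rightarrow> 'a"
  assumes S: "C0_semigroup S" and a: "(a \<longlongrightarrow> a0) G" "\<forall>\<^sub>F k in G. 0 \<le> a k" "0 \<le> a0" and y: "(y \<longlongrightarrow> y0) G"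
  shows "((\<lambda>k. S (a k) (y k)) \<longlongrightarrow> S a0 y0) G"
proof -
  have "continuous_on ({0..} \<times> UNIV) (\<lambda>v. S (fst v) (snd v))"
    by (intro C0_semigroup_continuous_on[OF S] continuous_intros) auto
  from continuous_on_tendsto_compose[OF this tendsto_Pair[OF a(1) y]] show ?thesis
    using a by simp
qed

text \<open>On \<open>[r, t]\<close> the mild equation restarted at \<open>r > 0\<close> passes to the limit because the
  forcing terms converge uniformly there; \<open>r\<close> then tends to \<open>0\<close>.\<close>

lemma mild_limit:
  fixes S :: "real \<Rightarrow> 'a::{banach, second_countable_topology} \<Rightarrow> 'a"
  assumes S: "C0_semigroup S" and t: "0 < t"
    and \<tau>: "\<And>k. 0 < \<tau> k" "\<And>k. \<tau> k \<le> t" "\<tau> \<longlonglongrightarrow> 0"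
    and qn: "\<forall>\<^sub>F n in sequentially. continuous_on {0..t} (qn n)"
    and mild: "\<forall>\<^sub>F n in sequentially. \<forall>r\<in>insert t (range \<tau>).
      xn n r = S r (y n) + (LINT s:{0..r}|lborel. S (r - s) (qn n s)) + w r"
    and xn: "\<And>r. r \<in> insert t (range \<tau>) \<Longrightarrow> (\<lambda>n. xn n r) \<longlonglongrightarrow> x r"
    and q: "continuous_on {0<..t} q" "\<And>s. s \<in> {0<..t} \<Longrightarrow> norm (q s) \<le> B"
    and lim_q: "\<And>k. uniform_limit {\<tau> k..t} qn q sequentially"
    and x0: "(\<lambda>k. x (\<tau> k)) \<longlonglongrightarrow> x0" and w0: "(\<lambda>k. w (\<tau> k)) \<longlonglongrightarrow> w0"
  shows "x t = S t (x0 - w0) + (LINT s:{0..t}|lborel. S (t - s) (q s)) + w t"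
proof -
  obtain N where N: "0 \<le> N" "\<And>u x. 0 \<le> u \<Longrightarrow> u \<le> t \<Longrightarrow> norm (S u x) \<le> N * norm x"
    using C0_semigroup_locally_bounded[OF S] by blast
  have bl: "bounded_linear (S u)" if "0 \<le> u" for u
    using S that by (rule C0_semigroup_bounded_linear)
  define c where "c r = (LINT s:{0..r}|lborel. S (r - s) (q s))" for r
  \<comment> \<open>Here \<open>n\<close> tends to infinity with the restart time fixed. Subtracting
    the convolution \<open>c\<close> turns the integral from \<open>\<tau> k\<close> to
    \<open>t\<close> into one over \<open>{0..t}\<close>.\<close>
  have restart: "x t - w t = S (t - \<tau> k) (x (\<tau> k) - w (\<tau> k) - c (\<tau> k)) + c t" for k
  proof -
    define r where "r = \<tau> k"
    have r: "0 < r" "r \<le> t" "r \<in> insert t (range \<tau>)" using \<tau> by (auto simp: r_def)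
    define J where "J h = (LINT s:{r..t}|lborel. S (t - s) (h s))" for h
    have qr: "continuous_on {r<..t} q" "\<And>s. s \<in> {r<..t} \<Longrightarrow> norm (q s) \<le> B"
      using r q by (auto intro: continuous_on_subset)
    have iq: "set_integrable lborel {r..t} (\<lambda>s. S (t - s) (q s))"
      by (rule C0_convolution_integrable[OF S qr order_refl])
    have bound: "\<forall>\<^sub>F n in sequentially. norm (J (qn n) - J q) \<le> N * e * (t - r)" if e: "0 < e" for e
      using qn uniform_limitD[OF lim_q[of k] e]
    proof eventually_elim
      case (elim n)
      have c: "continuous_on {r..t} (qn n)" using elim(1) r by (auto intro: continuous_on_subset)
      then have "bounded (qn n ` {r..t})" by (intro compact_imp_bounded compact_continuous_image) auto
      then obtain K where K: "\<And>s. s \<in> {r..t} \<Longrightarrow> norm (qn n s) \<le> K"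
        unfolding bounded_iff by blast
      have i: "set_integrable lborel {r..t} (\<lambda>s. S (t - s) (qn n s))"
        by (rule C0_convolution_integrable[OF S _ K order_refl]) (use c in \<open>auto intro: continuous_on_subset\<close>)
      have "J (qn n) - J q = (LINT s:{r..t}|lborel. S (t - s) (qn n s) - S (t - s) (q s))"
        unfolding J_def using set_integral_diff(2)[OF i iq] by simp
      also have "norm \<dots> \<le> N * e * (t - r)"
      proof (rule norm_set_integral_le)
        fix s assume s: "s \<in> {r<..t}"
        have "S (t - s) (qn n s) - S (t - s) (q s) = S (t - s) (qn n s - q s)"
          using bl[of "t - s"] s by (simp add: linear_diff bounded_linear.linear)
        also have "norm \<dots> \<le> N * norm (qn n s - q s)" using s r by (intro N) auto
        also have "\<dots> \<le> N * e"
          using elim(2) s r N(1) by (intro mult_left_mono) (auto simp: r_def dist_norm intro: less_imp_le)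
        finally show "norm (S (t - s) (qn n s) - S (t - s) (q s)) \<le> N * e" .
      qed (use r i iq in auto)
      finally show ?case .
    qed
    have J: "(\<lambda>n. J (qn n)) \<longlonglongrightarrow> J q"
    proof (rule tendstoI)
      fix e :: real assume e: "0 < e"
      \<comment> \<open>The added 1 keeps the denominator positive when \<open>N * (t - r)\<close>
        vanishes, for instance at \<open>r = t\<close>.\<close>
      define e' where "e' = e / (N * (t - r) + 1)"
      have p: "0 < N * (t - r) + 1" using N(1) r by (simp add: add_nonneg_pos)
      have e': "0 < e'" using e p by (simp add: e'_def)
      have "N * e' * (t - r) < e"
      proof -
        have "e' * (N * (t - r) + 1) = e" using p by (simp add: e'_def)
        then show ?thesis using e' by (simp add: algebra_simps)
      qed
      then show "\<forall>\<^sub>F n in sequentially. dist (J (qn n)) (J q) < e"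
        using bound[OF e'] by (auto simp: dist_norm elim!: eventually_mono)
    qed
    have "\<forall>\<^sub>F n in sequentially. xn n t - w t = S (t - r) (xn n r - w r) + J (qn n)"
      using qn mild
    proof eventually_elim
      case (elim n)
      have "bounded (qn n ` {0..t})" using elim(1) by (intro compact_imp_bounded compact_continuous_image) auto
      then obtain K where K: "\<And>s. s \<in> {0..t} \<Longrightarrow> norm (qn n s) \<le> K"
        unfolding bounded_iff by blast
      have c: "continuous_on {0<..t} (qn n)" using elim(1) by (auto intro: continuous_on_subset)
      have "xn n t - w t = S t (y n) + (LINT s:{0..t}|lborel. S (t - s) (qn n s))" using elim(2) by simp
      also have "(LINT s:{0..t}|lborel. S (t - s) (qn n s))
          = S (t - r) (LINT s:{0..r}|lborel. S (r - s) (qn n s)) + J (qn n)"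
        unfolding J_def by (rule C0_convolution_split[OF S c K]) (use r in auto)
      also have "S t (y n) = S (t - r) (S r (y n))"
        using r by (simp flip: C0_semigroup_add[OF S])
      also have "S (t - r) (S r (y n)) + (S (t - r) (LINT s:{0..r}|lborel. S (r - s) (qn n s)) + J (qn n))
          = S (t - r) (S r (y n) + (LINT s:{0..r}|lborel. S (r - s) (qn n s))) + J (qn n)"
        using bl[of "t - r"] r by (simp add: linear_add bounded_linear.linear)
      \<comment> \<open>The equation at the restart time absorbs the initial value
        \<open>y n\<close> and the early integral, leaving only terms whose limits are
        known.\<close>
      also have "S r (y n) + (LINT s:{0..r}|lborel. S (r - s) (qn n s)) = xn n r - w r"
        using bspec[OF elim(2) r(3)] by simp
      finally show ?case .
    qed
    moreover have "(\<lambda>n. S (t - r) (xn n r - w r) + J (qn n)) \<longlonglongrightarrow> S (t - r) (x r - w r) + J q"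
      using r by (intro tendsto_add J bounded_linear.tendsto[OF bl] tendsto_diff xn tendsto_const) auto
    ultimately have "(\<lambda>n. xn n t - w t) \<longlonglongrightarrow> S (t - r) (x r - w r) + J q"
      by (rule tendsto_cong[THEN iffD2])
    moreover have "(\<lambda>n. xn n t - w t) \<longlonglongrightarrow> x t - w t"
      by (intro tendsto_intros xn) simp
    ultimately have "x t - w t = S (t - r) (x r - w r) + J q" using LIMSEQ_unique by blast
    moreover have "c t = S (t - r) (c r) + J q"
      unfolding c_def J_def by (rule C0_convolution_split[OF S q]) (use r in auto)
    ultimately show ?thesis
      using bl[of "t - r"] r by (simp add: linear_diff bounded_linear.linear flip: r_def)
  qed
  have "continuous_on {0..t} c"
    unfolding c_def by (rule C0_convolution_continuous_on[OF S q])
  then have "(\<lambda>k. c (\<tau> k)) \<longlonglongrightarrow> c 0"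
    by (rule continuous_on_tendsto_compose[OF _ \<tau>(3)]) (use \<tau> t in \<open>auto intro: always_eventually less_imp_le\<close>)
  moreover have "c 0 = 0" by (simp add: c_def set_integral_singleton)
  ultimately have c0: "(\<lambda>k. c (\<tau> k)) \<longlonglongrightarrow> 0" by simp
  \<comment> \<open>Now the restart time tends to 0, and joint continuity of the semigroup handles
    its moving time and argument together.\<close>
  have "(\<lambda>k. t - \<tau> k) \<longlonglongrightarrow> t - 0" by (intro tendsto_intros \<tau>)
  then have "(\<lambda>k. S (t - \<tau> k) (x (\<tau> k) - w (\<tau> k) - c (\<tau> k)) + c t) \<longlonglongrightarrow> S (t - 0) (x0 - w0 - 0) + c t"
    by (intro tendsto_add C0_semigroup_tendsto[OF S] tendsto_diff x0 w0 c0 tendsto_const)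
      (use \<tau> t in \<open>auto intro: always_eventually\<close>)
  then have "(\<lambda>k::nat. x t - w t) \<longlonglongrightarrow> S t (x0 - w0) + c t" by (simp flip: restart)
  then have "x t - w t = S t (x0 - w0) + c t" by (simp add: LIMSEQ_const_iff)
  then show ?thesis by (simp add: c_def algebra_simps)
qed

text \<open>Since \<open>n R(n) x\<close> converges, \<open>R(n) x\<close> tends to \<open>0\<close>, so closedness of \<open>A\<close> identifies the limit.\<close>

lemma yosida_limit:
  assumes A: "linear_operator D A" and R: "real_resolvent D A \<mu> R"
    and Rn: "\<forall>\<^sub>F n in sequentially. real_resolvent D A (real n) (resolvent D A (real n))"
    and lim: "(\<lambda>n. real n *\<^sub>R resolvent D A (real n) x) \<longlonglongrightarrow> y"
  shows "y = x"
proof -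
  define u where "u n = resolvent D A (real n) x" for n
  interpret R: bounded_linear R using R by (simp add: real_resolvent_def)
  have "(\<lambda>n. inverse (real n) *\<^sub>R (real n *\<^sub>R u n)) \<longlonglongrightarrow> 0 *\<^sub>R y"
    unfolding u_def by (intro tendsto_scaleR lim lim_inverse_n)
  moreover have "\<forall>\<^sub>F n in sequentially. inverse (real n) *\<^sub>R (real n *\<^sub>R u n) = u n"
    using eventually_gt_at_top[of "0::nat"] by eventually_elim simp
  ultimately have u0: "u \<longlonglongrightarrow> 0" using Lim_transform_eventually by fastforce
  \<comment> \<open>The fixed bounded resolvent \<open>R\<close> encodes closedness of
    \<open>A\<close>: the relation for \<open>A (u n)\<close> becomes an equation preserved by
    limits, and it yields \<open>R (x - y) = 0\<close>.\<close>
  have "\<forall>\<^sub>F n in sequentially. R (\<mu> *\<^sub>R u n - (real n *\<^sub>R u n - x)) = u n"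
    using Rn
  proof eventually_elim
    case (elim n)
    then have "A (u n) = real n *\<^sub>R u n - x" "u n \<in> D"
      using real_resolvent_generator[OF elim] by (auto simp: u_def real_resolvent_def)
    then show ?case using R unfolding real_resolvent_def by metis
  qed
  moreover have "(\<lambda>n. R (\<mu> *\<^sub>R u n - (real n *\<^sub>R u n - x))) \<longlonglongrightarrow> R (\<mu> *\<^sub>R 0 - (y - x))"
    using lim by (intro R.tendsto tendsto_intros u0) (simp add: u_def)
  ultimately have "u \<longlonglongrightarrow> R (x - y)" using Lim_transform_eventually by fastforce
  then have Rz: "R (x - y) = 0" using u0 LIMSEQ_unique by blast
  have "0 \<in> D" "A 0 = 0"
    using A by (auto simp: linear_operator_def subspace_0) (metis scaleR_zero_left subspace_0)
  moreover have "\<mu> *\<^sub>R R (x - y) - A (R (x - y)) = x - y" using R by (simp add: real_resolvent_def)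
  ultimately show ?thesis using Rz by simp
qed

text \<open>Functions within distance 1 of the limit stay in the ball of radius
  \<open>K + 1\<close>, where one Lipschitz constant applies to all of them.\<close>

lemma uniform_limit_Lipschitz_on_bounded:
  fixes f :: "'a::real_normed_vector \<Rightarrow> 'b::real_normed_vector"
  assumes f: "\<And>B. bounded B \<Longrightarrow> \<exists>L. L-lipschitz_on B f"
    and lim: "uniform_limit I un u G" and u: "\<And>s. s \<in> I \<Longrightarrow> norm (u s) \<le> K"
  shows "uniform_limit I (\<lambda>n s. f (un n s)) (\<lambda>s. f (u s)) G"
proof (rule uniform_limitI)
  fix e :: real assume e: "0 < e"
  obtain L where L: "L-lipschitz_on (cball 0 (K + 1)) f" using f[OF bounded_cball] by blast
  have L0: "0 \<le> L" using L by (rule lipschitz_on_nonneg)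
  define e' where "e' = min 1 (e / (L + 1))"
  have e': "0 < e'" "e' \<le> 1" "L * e' < e"
  proof -
    show "0 < e'" "e' \<le> 1" using e L0 by (auto simp: e'_def)
    have "L * e' \<le> L * (e / (L + 1))" using L0 by (intro mult_left_mono) (auto simp: e'_def)
    also have "\<dots> < e" using L0 e by (simp add: field_simps)
    finally show "L * e' < e" .
  qed
  show "\<forall>\<^sub>F n in G. \<forall>s\<in>I. dist (f (un n s)) (f (u s)) < e"
    using uniform_limitD[OF lim e'(1)]
  proof eventually_elim
    case (elim n)
    show ?case
    proof
      fix s assume s: "s \<in> I"
      have d: "dist (un n s) (u s) < e'" using elim s by blast
      have "norm (un n s) \<le> norm (un n s - u s) + norm (u s)"
        using norm_triangle_ineq[of "un n s - u s" "u s"] by simp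
      then have "norm (un n s) \<le> K + 1" using d e' u[OF s] by (simp add: dist_norm)
      then have "dist (f (un n s)) (f (u s)) \<le> L * dist (un n s) (u s)"
        using u[OF s] by (intro lipschitz_onD[OF L]) auto
      also have "\<dots> \<le> L * e'" using d L0 by (intro mult_left_mono) auto
      finally show "dist (f (un n s)) (f (u s)) < e" using e' by simp
    qed
  qed
qed

lemma Lipschitz_on_bounded_imp_continuous_on:
  fixes f :: "'a::real_normed_vector \<Rightarrow> 'b::real_normed_vector"
  assumes f: "\<And>B. bounded B \<Longrightarrow> \<exists>L. L-lipschitz_on B f"
  shows "continuous_on UNIV f"
proof -
  have "isCont f x" for x
  proof -
    obtain L where L: "L-lipschitz_on (ball x 1) f" using f[OF bounded_ball] by blast
    then have "continuous_on (ball x 1) f" by (rule lipschitz_on_continuous_on)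
    then show ?thesis by (rule continuous_on_interior) simp
  qed
  then show ?thesis by (simp add: continuous_at_imp_continuous_on)
qed

section \<open>Processes\<close>

lemma normal_filtered_prob_spaceD:
  assumes "normal_filtered_prob_space P Fil"
  shows "prob_space P" "complete_measure P" "0 \<le> t \<Longrightarrow> subalgebra P (Fil t)"
    "null_sets P \<subseteq> sets (Fil 0)"
proof -
  note c = assms[unfolded normal_filtered_prob_space_def]
  note c2 = c[THEN conjunct2] note c3 = c2[THEN conjunct2]
  note c4 = c3[THEN conjunct2] note c5 = c4[THEN conjunct2]
  show "prob_space P" by (rule c[THEN conjunct1])
  show "complete_measure P" by (rule c2[THEN conjunct1])
  show "0 \<le> t \<Longrightarrow> subalgebra P (Fil t)" by (rule c3[THEN conjunct1, rule_format])
  show "null_sets P \<subseteq> sets (Fil 0)" by (rule c5[THEN conjunct1])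
qed

text \<open>Completeness makes every subset of the exceptional set null, and null sets belong to
  \<open>N\<close>; hence the preimages differ by sets measurable in \<open>N\<close>. This is used
  for adaptedness at time 0.\<close>

lemma borel_measurable_AE_eq:
  assumes P: "complete_measure P" and sub: "subalgebra P N" and null: "null_sets P \<subseteq> sets N"
    and f: "f \<in> borel_measurable N" and eq: "AE \<omega> in P. g \<omega> = f \<omega>"
  shows "g \<in> borel_measurable N"
proof (rule measurableI)
  interpret complete_measure P by (rule P)
  have sp: "space N = space P" using sub by (simp add: subalgebra_def)
  define Z where "Z = {\<omega> \<in> space P. g \<omega> \<noteq> f \<omega>}"
  have Z: "Z \<in> null_sets P" using eq by (simp add: AE_iff_null_sets Z_def)
  fix B :: "'b set" assume B: "B \<in> sets borel"
  have "g -` B \<inter> Z \<in> null_sets P" by (rule complete2[OF _ Z]) auto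
  then have "(f -` B \<inter> space N - Z) \<union> (g -` B \<inter> Z) \<in> sets N"
    using f B Z null by (intro sets.Un sets.Diff measurable_sets) auto
  moreover have "(f -` B \<inter> space N - Z) \<union> (g -` B \<inter> Z) = g -` B \<inter> space N"
    by (auto simp: Z_def sp)
  ultimately show "g -` B \<inter> space N \<in> sets N" by simp
qed auto

lemma closure_Rats_Int_interval:
  fixes a b :: real
  assumes "a < b"
  shows "closure (\<rat> \<inter> {a<..<b}) = {a..b}"
proof -
  have "closure ({a<..<b} \<inter> \<rat>) = closure {a<..<b}"
    by (rule closure_open_Int_superset) (auto simp: Rats_closure_real)
  then show ?thesis using assms by (simp add: Int_commute)
qed

text \<open>The supremum over all times is replaced by a measurable one over rational times, whose
  finite integral makes it finite almost surely. Path continuity extends the bound to the remaining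
  times.\<close>

lemma Cp_process_AE_bounded:
  fixes Y :: "real \<Rightarrow> 'w \<Rightarrow> 'k::real_normed_vector"
  assumes Y: "Cp_process P Fil p {0<..T} Y" and p: "1 \<le> p" and T: "0 < T"
    and sub: "\<And>t. 0 \<le> t \<Longrightarrow> subalgebra P (Fil t)"
  shows "AE \<omega> in P. \<exists>K. \<forall>t\<in>{0<..T}. norm (Y t \<omega>) \<le> K"
proof -
  define Q where "Q = \<rat> \<inter> {0<..<T}"
  define G where "G \<omega> = (SUP t\<in>Q. ennreal (norm (Y t \<omega>) powr p))" for \<omega>
  have "countable Q" unfolding Q_def by (intro countable_Int1 countable_rat)
  moreover have "(\<lambda>\<omega>. ennreal (norm (Y t \<omega>) powr p)) \<in> borel_measurable P" if "t \<in> Q" for t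
  proof -
    have "Y t \<in> borel_measurable (Fil t)"
      using Y that by (auto simp: Cp_process_def adapted_on_def Q_def)
    then have "Y t \<in> borel_measurable P"
      by (rule measurable_from_subalg[OF sub, rotated]) (use that in \<open>simp add: Q_def\<close>)
    then show ?thesis by simp
  qed
  ultimately have G: "G \<in> borel_measurable P"
    unfolding G_def by (intro borel_measurable_SUP) auto
  have "G \<omega> \<le> (SUP t\<in>closure {0<..T}. ennreal (norm (Y t \<omega>) powr p))" for \<omega>
    unfolding G_def using T by (intro SUP_subset_mono) (auto simp: Q_def)
  then have "integral\<^sup>N P G \<le> (\<integral>\<^sup>+\<omega>. (SUP t\<in>closure {0<..T}. ennreal (norm (Y t \<omega>) powr p)) \<partial>P)"
    by (intro nn_integral_mono)
  also have "\<dots> < \<infinity>" using Y by (simp add: Cp_process_def)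
  finally have "AE \<omega> in P. G \<omega> \<noteq> \<infinity>" using G by (intro nn_integral_PInf_AE) auto
  moreover have "AE \<omega> in P. continuous_on {0<..T} (\<lambda>t. Y t \<omega>)"
    using Y by (simp add: Cp_process_def)
  ultimately show ?thesis
  proof eventually_elim
    case (elim \<omega>)
    obtain c where c: "0 \<le> c" "G \<omega> = ennreal c" using elim(1) by (cases "G \<omega>") auto
    have le: "norm (Y t \<omega>) \<le> max 1 c" if "t \<in> Q" for t
    proof (cases "norm (Y t \<omega>) \<le> 1")
      case False
      have "ennreal (norm (Y t \<omega>) powr p) \<le> ennreal c"
        unfolding c(2)[symmetric] G_def using that by (rule SUP_upper)
      then have "norm (Y t \<omega>) powr p \<le> c" using c by (simp add: ennreal_le_iff)
      \<comment> \<open>Powers with exponent \<open>p \<ge> 1\<close> dominate the norm only above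
        1, hence the maximum with 1 in the bound.\<close>
      moreover have "norm (Y t \<omega>) powr 1 \<le> norm (Y t \<omega>) powr p"
        using False p by (intro powr_mono) auto
      ultimately show ?thesis using False by simp
    qed simp
    show ?case
    proof (intro exI ballI)
      fix t assume t: "t \<in> {0<..T}"
      \<comment> \<open>Rationals to the left of \<open>t\<close> suffice, which also covers the
        right end point and stays away from 0.\<close>
      have cl: "closure (\<rat> \<inter> {t / 2<..<t}) = {t / 2..t}"
        using t by (intro closure_Rats_Int_interval) simp
      have "continuous_on {t / 2..t} (\<lambda>t. norm (Y t \<omega>))"
        using t by (intro continuous_on_norm continuous_on_subset[OF elim(2)]) auto
      then show "norm (Y t \<omega>) \<le> max 1 c"
        unfolding cl[symmetric]
        by (rule continuous_le_on_closure) (use t le in \<open>auto simp: cl Q_def\<close>)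
    qed
  qed
qed

section \<open>Pathwise comparison of two solutions\<close>

lemma (in embedded_generator) forcing_bounded_continuous:
  assumes f: "\<And>B. bounded B \<Longrightarrow> \<exists>L. L-lipschitz_on B f"
    and Y: "continuous_on I Y" "\<And>s. s \<in> I \<Longrightarrow> norm (Y s) \<le> K"
  obtains B where "continuous_on I (\<lambda>s. j (f (Y s)))" "\<And>s. s \<in> I \<Longrightarrow> norm (f (Y s)) \<le> B"
    "\<And>s. s \<in> I \<Longrightarrow> norm (j (f (Y s))) \<le> B"
proof -
  obtain L where L: "L-lipschitz_on (cball 0 \<bar>K\<bar>) f" using f[OF bounded_cball] by blast
  obtain N where N: "0 < N" "\<And>e. norm (j e) \<le> norm e * N" using j.pos_bounded by blast
  define B where "B = norm (f 0) + L * \<bar>K\<bar>"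
  have B: "norm (f (Y s)) \<le> B" if "s \<in> I" for s
  proof -
    have "norm (f (Y s) - f 0) \<le> L * norm (Y s)"
      using lipschitz_onD[OF L, of "Y s" 0] Y(2)[OF that] by (simp add: dist_norm)
    also have "\<dots> \<le> L * \<bar>K\<bar>"
      using Y(2)[OF that] lipschitz_on_nonneg[OF L] by (intro mult_left_mono) auto
    finally show ?thesis
      unfolding B_def using norm_triangle_ineq[of "f (Y s) - f 0" "f 0"] by simp
  qed
  show ?thesis
  proof
    show "continuous_on I (\<lambda>s. j (f (Y s)))"
      by (intro j.continuous_on continuous_on_compose2[OF Lipschitz_on_bounded_imp_continuous_on[OF f] Y(1)]) auto
    fix s assume s: "s \<in> I"
    have "norm (j (f (Y s))) \<le> B * N"
      using N(1) B[OF s] by (intro order_trans[OF N(2)] mult_right_mono) auto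
    then show "norm (j (f (Y s))) \<le> max B (B * N)" by simp
    show "norm (f (Y s)) \<le> max B (B * N)" using B[OF s] by simp
  qed
qed

text \<open>The deterministic core of uniqueness, for one fixed path. The noise has cancelled, and
  the identity is asked only at rational times so that countably many null sets suffice
  later.\<close>

lemma (in embedded_generator) mild_paths_eq:
  fixes X Y :: "real \<Rightarrow> 'e"
  assumes A: "quasi_dissipative \<omega> domE genE" and T: "0 < T"
    and f: "\<And>B. bounded B \<Longrightarrow> \<exists>L. L-lipschitz_on B f"
    and X: "continuous_on {0<..T} X" "\<And>s. s \<in> {0<..T} \<Longrightarrow> norm (X s) \<le> K" "continuous_on {0..T} (\<lambda>s. j (X s))"
    and Y: "continuous_on {0<..T} Y" "\<And>s. s \<in> {0<..T} \<Longrightarrow> norm (Y s) \<le> K'" "continuous_on {0..T} (\<lambda>s. j (Y s))"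
    and eq: "\<And>t. t \<in> \<rat> \<inter> {0<..<T} \<Longrightarrow> j (X t) - (LINT s:{0..t}|lborel. S (t - s) (j (f (X s))))
      = j (Y t) - (LINT s:{0..t}|lborel. S (t - s) (j (f (Y s))))"
    and t: "t \<in> {0..T}"
  shows "X t = Y t"
proof -
  obtain BX where BX: "continuous_on {0<..T} (\<lambda>s. j (f (X s)))" "\<And>s. s \<in> {0<..T} \<Longrightarrow> norm (f (X s)) \<le> BX"
    "\<And>s. s \<in> {0<..T} \<Longrightarrow> norm (j (f (X s))) \<le> BX"
    using forcing_bounded_continuous[OF f X(1,2)] by blast
  obtain BY where BY: "continuous_on {0<..T} (\<lambda>s. j (f (Y s)))" "\<And>s. s \<in> {0<..T} \<Longrightarrow> norm (f (Y s)) \<le> BY"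
    "\<And>s. s \<in> {0<..T} \<Longrightarrow> norm (j (f (Y s))) \<le> BY"
    using forcing_bounded_continuous[OF f Y(1,2)] by blast
  define d where "d s = X s - Y s" for s
  define g where "g s = f (X s) - f (Y s)" for s
  \<comment> \<open>Continuity in the larger space extends the identity from rational times to the
    closed interval, including 0.\<close>
  define \<phi> where "\<phi> t = (j (X t) - (LINT s:{0..t}|lborel. S (t - s) (j (f (X s)))))
      - (j (Y t) - (LINT s:{0..t}|lborel. S (t - s) (j (f (Y s)))))" for t
  have cl: "closure (\<rat> \<inter> {0<..<T}) = {0..T}" by (rule closure_Rats_Int_interval[OF T])
  have c\<phi>: "continuous_on {0..T} \<phi>"
    unfolding \<phi>_def
    by (intro continuous_on_diff X Y C0_convolution_continuous_on[OF C0 BX(1,3)] C0_convolution_continuous_on[OF C0 BY(1,3)])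
  have \<phi>: "\<phi> t = 0" if "t \<in> {0..T}" for t
    by (rule continuous_constant_on_closure[of "\<rat> \<inter> {0<..<T}"])
      (use c\<phi> cl eq that in \<open>auto simp: \<phi>_def\<close>)
  have conv: "j (d t) = (LINT s:{0..t}|lborel. S (t - s) (j (g s)))" if t: "t \<in> {0..T}" for t
  proof -
    have sub: "{0<..t} \<subseteq> {0<..T}" using t by auto
    have i: "set_integrable lborel {0..t} (\<lambda>s. S (t - s) (j (f (X s))))"
      "set_integrable lborel {0..t} (\<lambda>s. S (t - s) (j (f (Y s))))"
      by (rule C0_convolution_integrable[OF C0 continuous_on_subset[OF BX(1) sub] BX(3) order_refl],
          use t in simp,
          rule C0_convolution_integrable[OF C0 continuous_on_subset[OF BY(1) sub] BY(3) order_refl],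
          use t in simp)
    have "(LINT s:{0..t}|lborel. S (t - s) (j (g s)))
        = (LINT s:{0..t}|lborel. S (t - s) (j (f (X s))) - S (t - s) (j (f (Y s))))"
    proof (rule set_lebesgue_integral_cong)
      show "\<forall>s. s \<in> {0..t} \<longrightarrow> S (t - s) (j (g s)) = S (t - s) (j (f (X s))) - S (t - s) (j (f (Y s)))"
        using C0_semigroup_bounded_linear[OF C0]
        by (auto simp: g_def j.diff linear_diff bounded_linear.linear)
    qed simp
    also have "\<dots> = (LINT s:{0..t}|lborel. S (t - s) (j (f (X s)))) - (LINT s:{0..t}|lborel. S (t - s) (j (f (Y s))))"
      by (rule set_integral_diff(2)[OF i])
    also have "\<dots> = j (d t)" using \<phi>[OF t] by (simp add: \<phi>_def d_def j.diff algebra_simps)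
    finally show ?thesis by simp
  qed
  obtain L where L: "L-lipschitz_on (cball 0 (max K K')) f" using f[OF bounded_cball] by blast
  have cf: "continuous_on UNIV f" using f by (rule Lipschitz_on_bounded_imp_continuous_on)
  have pos: "d s = 0" if "s \<in> {0<..T}" for s
  proof (rule convolution_Lipschitz_imp_zero[OF A _ _ _ _ lipschitz_on_nonneg[OF L] conv that])
    show "continuous_on {0<..T} d" unfolding d_def by (intro continuous_intros X Y)
    show "norm (d s) \<le> K + K'" if "s \<in> {0<..T}" for s
      unfolding d_def using X(2)[OF that] Y(2)[OF that] norm_triangle_ineq4[of "X s" "Y s"] by simp
    show "continuous_on {0<..T} g"
      unfolding g_def
      by (intro continuous_on_diff continuous_on_compose2[OF cf X(1)] continuous_on_compose2[OF cf Y(1)]) auto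
    show "norm (g s) \<le> L * norm (d s)" if "s \<in> {0<..T}" for s
      unfolding g_def d_def dist_norm[symmetric]
      using X(2)[OF that] Y(2)[OF that] by (intro lipschitz_onD[OF L]) auto
  qed
  show ?thesis
  \<comment> \<open>The contraction argument covers positive times; at 0 the convolution over a
    single point vanishes and \<open>j\<close> is injective.\<close>
  proof (cases "t = 0")
    case True
    have "j (X 0) = j (Y 0)" using conv[of 0] T by (simp add: set_integral_singleton d_def j.diff)
    then show ?thesis using True injD[OF inj_j] by blast
  next
    case False
    then show ?thesis using pos[of t] t by (simp add: d_def)
  qed
qed

theorem theorem3p12:
  fixes P :: "'w measure"
    and Fil :: "real \<Rightarrow> 'w measure"
    and W :: "real \<Rightarrow> 'x::{real_inner, banach, second_countable_topology} \<Rightarrow> 'w \<Rightarrow> real"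
    and domA :: "'x set" and A :: "'x \<Rightarrow> 'x"
    and S :: "real \<Rightarrow> 'x \<Rightarrow> 'x"
    and C :: "'x \<Rightarrow> 'x"
    and domF :: "'x set" and F :: "'x \<Rightarrow> 'x"
    and j :: "'e::banach \<Rightarrow> 'x"
    and WA :: "real \<Rightarrow> 'w \<Rightarrow> 'e"
    and \<zeta> M :: real and m :: nat
    and x :: 'e
    and Xn :: "nat \<Rightarrow> real \<Rightarrow> 'w \<Rightarrow> 'e"
    and X :: "real \<Rightarrow> 'w \<Rightarrow> 'e"
  assumes setting:
      "normal_filtered_prob_space P Fil"
      "cylindrical_Wiener P Fil W"
      "nonneg_selfadjoint C"
    and hyp_i:
      "bounded_linear j" "inj j" "closure (range j) = UNIV" "range j \<in> sets borel"
      "range j \<subseteq> domF" "F ` range j \<subseteq> range j"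
    and hyp_ii:
      "generates_C0_semigroup domA A S"
      "generates_analytic_semigroup domA A"
      "generates_analytic_semigroup (part_dom j domA A) (part_map j A)"
    and hyp_iii:
      "dissipative_on (domA \<inter> domF) (\<lambda>y. A y + F y - \<zeta> *\<^sub>R y)"
      "dissipative_on (part_dom j domA A) (\<lambda>y. part_map j A y + part_map j F y - \<zeta> *\<^sub>R y)"
    and hyp_iv:
      "\<forall>t\<ge>0. has_stochastic_integral P W t (\<lambda>s y. S (t - s) (sqrt_op C y)) (\<lambda>\<omega>. j (WA t \<omega>))"
      "adapted_on Fil {0..} WA"
      "AE \<omega> in P. continuous_on {0..} (\<lambda>t. WA t \<omega>)"
      "\<forall>T>0. (\<integral>\<^sup>+s\<in>{0..T}. op_trace (\<lambda>y. S s (C (adjoint (S s) y))) \<partial>lborel) < \<infinity>"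
    and hyp_v:
      "M > 0" "\<forall>y. norm (part_map j F y) \<le> M * (1 + norm y ^ m)"
    and hyp_vi:
      "\<forall>B. bounded B \<longrightarrow> (\<exists>L. L-lipschitz_on B (part_map j F))"
    and Xn_def:
      "\<forall>\<^sub>F n in sequentially.
         of_nat n \<in> resolvent_set domA A \<and> of_nat n \<in> resolvent_set (part_dom j domA A) (part_map j A) \<and>
         (\<forall>p\<ge>1. \<forall>T>0. Cp_process P Fil p {0..T} (Xn n)) \<and>
         mild_equation P Fil j S F WA {0..} (real n *\<^sub>R resolvent domA A (real n) (j x)) (Xn n)"
    and X_limit:
      "\<forall>p\<ge>1. \<forall>T>0. Cp_process P Fil p {0<..T} X"
      "\<forall>p\<ge>1. \<forall>T>0. Cp_process P Fil p {0..T} (\<lambda>t \<omega>. j (X t \<omega>))"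
      "\<forall>T>0. AE \<omega> in P.
         uniform_limit {0..T} (\<lambda>n t. j (Xn n t \<omega>)) (\<lambda>t. j (X t \<omega>)) sequentially"
      "\<forall>T>0. \<forall>\<epsilon>. 0 < \<epsilon> \<and> \<epsilon> \<le> T \<longrightarrow> (AE \<omega> in P.
         uniform_limit {\<epsilon>..T} (\<lambda>n t. Xn n t \<omega>) (\<lambda>t. X t \<omega>) sequentially)"
  shows "mild_equation P Fil j S F WA {0..} (j x) X \<and>
         (\<forall>p\<ge>1. \<forall>T>0.
           Cp_process P Fil p {0..T} (\<lambda>t \<omega>. j (X t \<omega>)) \<and> Cp_process P Fil p {0<..T} X \<and>
           (\<forall>Y. mild_equation P Fil j S F WA {0..T} (j x) Y \<and>
                Cp_process P Fil p {0..T} (\<lambda>t \<omega>. j (Y t \<omega>)) \<and> Cp_process P Fil p {0<..T} Y \<longrightarrow>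
                (\<forall>t\<in>{0..T}. AE \<omega> in P. Y t \<omega> = X t \<omega>)))"
proof -
  interpret embedded_generator domA A S j
    using hyp_ii hyp_i(1,2) by (rule embedded_generator.intro)
  interpret P: prob_space P by (rule normal_filtered_prob_spaceD[OF setting(1)])
  have P: "complete_measure P" and sub: "\<And>t. 0 \<le> t \<Longrightarrow> subalgebra P (Fil t)"
    and null: "null_sets P \<subseteq> sets (Fil 0)"
    by (fact normal_filtered_prob_spaceD[OF setting(1)])+
  define f where "f = part_map j F"
  have F: "F (j e) = j (f e)" for e
    using hyp_i(6) unfolding f_def part_map_def by (subst f_inv_into_f) auto
  have f: "\<exists>L. L-lipschitz_on B f" if "bounded B" for B using hyp_vi that by (simp add: f_def)
  define y where "y n = real n *\<^sub>R resolvent domA A (real n) (j x)" for n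
  obtain n0 where "\<forall>n\<ge>n0. of_nat n \<in> resolvent_set domA A \<and>
      of_nat n \<in> resolvent_set (part_dom j domA A) (part_map j A) \<and>
      (\<forall>p\<ge>1. \<forall>T>0. Cp_process P Fil p {0..T} (Xn n)) \<and> mild_equation P Fil j S F WA {0..} (y n) (Xn n)"
    using Xn_def unfolding eventually_sequentially y_def by (elim exE)
  note n0_all = this[rule_format]
  have n0: "of_nat n \<in> resolvent_set domA A" "0 < T \<Longrightarrow> Cp_process P Fil 1 {0..T} (Xn n)"
    "mild_equation P Fil j S F WA {0..} (y n) (Xn n)" if "n0 \<le> n" for n T
    using n0_all[OF that] order_refl[of "1::real"] by blast+
  have X_cont: "AE \<omega> in P. continuous_on {0<..T} (\<lambda>t. X t \<omega>)"
    and jX_cont: "AE \<omega> in P. continuous_on {0..T} (\<lambda>t. j (X t \<omega>))"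
    and X_bounded: "AE \<omega> in P. \<exists>K. \<forall>t\<in>{0<..T}. norm (X t \<omega>) \<le> K" if T: "0 < T" for T
  proof -
    have C: "Cp_process P Fil 1 {0<..T} X" "Cp_process P Fil 1 {0..T} (\<lambda>t \<omega>. j (X t \<omega>))"
      using X_limit(1,2) T by auto
    show "AE \<omega> in P. continuous_on {0<..T} (\<lambda>t. X t \<omega>)" "AE \<omega> in P. continuous_on {0..T} (\<lambda>t. j (X t \<omega>))"
      using C by (simp_all add: Cp_process_def)
    show "AE \<omega> in P. \<exists>K. \<forall>t\<in>{0<..T}. norm (X t \<omega>) \<le> K"
      by (rule Cp_process_AE_bounded[OF C(1) _ T sub]) simp
  qed
  have Xn_eq: "AE \<omega> in P. \<forall>n\<ge>n0. j (Xn n t \<omega>)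
      = S t (y n) + (LINT s:{0..t}|lborel. S (t - s) (F (j (Xn n s \<omega>)))) + j (WA t \<omega>)" if "0 \<le> t" for t
    unfolding AE_all_countable
  proof
    fix n
    show "AE \<omega> in P. n0 \<le> n \<longrightarrow> j (Xn n t \<omega>)
      = S t (y n) + (LINT s:{0..t}|lborel. S (t - s) (F (j (Xn n s \<omega>)))) + j (WA t \<omega>)"
    proof (cases "n0 \<le> n")
      case True
      then have "AE \<omega> in P. set_integrable lborel {0..t} (\<lambda>s. S (t - s) (F (j (Xn n s \<omega>)))) \<and>
        j (Xn n t \<omega>) = S t (y n) + (LINT s:{0..t}|lborel. S (t - s) (F (j (Xn n s \<omega>)))) + j (WA t \<omega>)"
        using n0(3) that unfolding mild_equation_def by blast
      then show ?thesis by eventually_elim simp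
    qed simp
  qed
  \<comment> \<open>At time 0 the approximate equation reads
    \<open>j (Xn n 0 \<omega>) = y n + j (WA 0 \<omega>)\<close>, so \<open>y\<close> converges and
    \<open>yosida_limit\<close> identifies its limit as \<open>j x\<close>. The term
    \<open>WA 0\<close> is carried along instead of being evaluated.\<close>
  have X0: "AE \<omega> in P. X 0 \<omega> = x + WA 0 \<omega>"
  proof -
    have "AE \<omega> in P. uniform_limit {0..1} (\<lambda>n t. j (Xn n t \<omega>)) (\<lambda>t. j (X t \<omega>)) sequentially"
      using X_limit(3) by simp
    with Xn_eq[of 0, simplified] show ?thesis
    proof eventually_elim
      case (elim \<omega>)
      have "(\<lambda>n. j (Xn n 0 \<omega>)) \<longlonglongrightarrow> j (X 0 \<omega>)"
        using elim(2) by (rule tendsto_uniform_limitI) simp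
      then have "(\<lambda>n. j (Xn n 0 \<omega>) - j (WA 0 \<omega>)) \<longlonglongrightarrow> j (X 0 \<omega>) - j (WA 0 \<omega>)"
        by (intro tendsto_intros)
      moreover have "\<forall>\<^sub>F n in sequentially. j (Xn n 0 \<omega>) - j (WA 0 \<omega>) = y n"
        using eventually_ge_at_top[of n0]
        by eventually_elim (use elim(1) in \<open>simp add: C0_semigroup_0[OF C0] set_integral_singleton\<close>)
      ultimately have lim: "y \<longlonglongrightarrow> j (X 0 \<omega>) - j (WA 0 \<omega>)"
        by (rule Lim_transform_eventually)
      obtain \<mu> R where R: "real_resolvent domA A \<mu> R"
        using eventually_happens[OF eventually_real_resolvent] by auto
      have A: "linear_operator domA A" by (rule sectorial_linear_operator[OF hyp_ii(2)])
      have "\<forall>\<^sub>F n in sequentially. real_resolvent domA A (real n) (resolvent domA A (real n))"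
        using eventually_ge_at_top[of n0]
        by eventually_elim (use n0(1) in \<open>intro resolvent_set_imp_real_resolvent[OF A], simp\<close>)
      from yosida_limit[OF A R this] lim have "j (X 0 \<omega>) - j (WA 0 \<omega>) = j x"
        unfolding y_def by blast
      then have "j (X 0 \<omega>) = j (x + WA 0 \<omega>)" by (simp add: j.add algebra_simps)
      then show ?case by (rule injD[OF inj_j])
    qed
  qed
  \<comment> \<open>Membership of \<open>X\<close> in the spaces over \<open>{0<..T}\<close> covers
    positive times; at 0 the almost sure formula \<open>X0\<close> is used.\<close>
  have X_adapted: "X t \<in> borel_measurable (Fil t)" if t: "0 \<le> t" for t
  proof (cases "t = 0")
    case True
    have "WA 0 \<in> borel_measurable (Fil 0)" using hyp_iv(2) by (simp add: adapted_on_def)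
    then have "(\<lambda>\<omega>. x + WA 0 \<omega>) \<in> borel_measurable (Fil 0)"
      by (rule measurable_compose[where N = borel and L = borel])
        (intro borel_measurable_continuous_onI continuous_intros)
    then show ?thesis
      unfolding True by (rule borel_measurable_AE_eq[OF P sub null _ X0, rotated]) simp
  next
    case False
    have "Cp_process P Fil 1 {0<..t} X" using X_limit(1) t False by simp
    then show ?thesis using t False by (simp add: Cp_process_def adapted_on_def)
  qed
  have mild_at: "AE \<omega> in P. set_integrable lborel {0..t} (\<lambda>s. S (t - s) (F (j (X s \<omega>)))) \<and>
      j (X t \<omega>) = S t (j x) + (LINT s:{0..t}|lborel. S (t - s) (F (j (X s \<omega>)))) + j (WA t \<omega>)"
    if t: "0 \<le> t" for t
  proof (cases "t = 0")
    case True
    show ?thesis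
      unfolding True using X0
    proof eventually_elim
      case (elim \<omega>)
      have "set_integrable lborel {0..0} (\<lambda>s. S (0 - s) (F (j (X s \<omega>))))"
        by (rule bounded_continuous_set_integrable) auto
      then show ?case
        using elim by (simp add: C0_semigroup_0[OF C0] set_integral_singleton j.add)
    qed
  next
    case False
    with t have t: "0 < t" by simp
    define \<tau> where "\<tau> k = t / real (Suc k)" for k
    have \<tau>: "0 < \<tau> k" "\<tau> k \<le> t" for k using t by (auto simp: \<tau>_def divide_simps)
    have "(\<lambda>k. t * inverse (real (Suc k))) \<longlonglongrightarrow> t * 0"
      by (intro tendsto_intros LIMSEQ_inverse_real_of_nat)
    then have \<tau>0: "\<tau> \<longlonglongrightarrow> 0" by (simp add: \<tau>_def[abs_def] divide_inverse)
    have 1: "AE \<omega> in P. \<forall>n\<ge>n0. continuous_on {0..t} (\<lambda>s. Xn n s \<omega>)"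
      unfolding AE_all_countable
    proof
      show "AE \<omega> in P. n0 \<le> n \<longrightarrow> continuous_on {0..t} (\<lambda>s. Xn n s \<omega>)" for n
        using n0(2)[of n t] t by (cases "n0 \<le> n") (auto simp: Cp_process_def)
    qed
    \<comment> \<open>The restart times and the indices \<open>n\<close> are countable, so one null
      set serves them all.\<close>
    have 2: "AE \<omega> in P. \<forall>r\<in>insert t (range \<tau>). \<forall>n\<ge>n0. j (Xn n r \<omega>)
      = S r (y n) + (LINT s:{0..r}|lborel. S (r - s) (F (j (Xn n s \<omega>)))) + j (WA r \<omega>)"
    proof (rule AE_ball_countable')
      fix r assume "r \<in> insert t (range \<tau>)"
      then have "0 \<le> r" using t \<tau> by (auto intro: less_imp_le)
      then show "AE \<omega> in P. \<forall>n\<ge>n0. j (Xn n r \<omega>)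
        = S r (y n) + (LINT s:{0..r}|lborel. S (r - s) (F (j (Xn n s \<omega>)))) + j (WA r \<omega>)"
        by (rule Xn_eq)
    qed auto
    have 3: "AE \<omega> in P. \<forall>k. uniform_limit {\<tau> k..t} (\<lambda>n s. Xn n s \<omega>) (\<lambda>s. X s \<omega>) sequentially"
      unfolding AE_all_countable using X_limit(4) t \<tau> by blast
    have 4: "AE \<omega> in P. uniform_limit {0..t} (\<lambda>n s. j (Xn n s \<omega>)) (\<lambda>s. j (X s \<omega>)) sequentially"
      using X_limit(3) t by blast
    show ?thesis
      using 1 2 3 4 X_cont[OF t] jX_cont[OF t] X_bounded[OF t] hyp_iv(3) X0
    proof eventually_elim
      case (elim \<omega>)
      obtain K where K: "\<And>s. s \<in> {0<..t} \<Longrightarrow> norm (X s \<omega>) \<le> K" using elim(7) by blast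
      obtain B where B: "continuous_on {0<..t} (\<lambda>s. j (f (X s \<omega>)))" "\<And>s. s \<in> {0<..t} \<Longrightarrow> norm (j (f (X s \<omega>))) \<le> B"
        using forcing_bounded_continuous[OF f elim(5) K] by blast
      have "j (X t \<omega>) = S t (j (X 0 \<omega>) - j (WA 0 \<omega>)) + (LINT s:{0..t}|lborel. S (t - s) (j (f (X s \<omega>)))) + j (WA t \<omega>)"
      proof (rule mild_limit[OF C0 t \<tau> \<tau>0, where xn = "\<lambda>n r. j (Xn n r \<omega>)"
            and qn = "\<lambda>n s. j (f (Xn n s \<omega>))" and y = y])
        show "\<forall>\<^sub>F n in sequentially. continuous_on {0..t} (\<lambda>s. j (f (Xn n s \<omega>)))"
          using eventually_ge_at_top[of n0]
          by eventually_elim (use elim(1) in \<open>intro j.continuous_on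
            continuous_on_compose2[OF Lipschitz_on_bounded_imp_continuous_on[OF f]], auto\<close>)
        show "\<forall>\<^sub>F n in sequentially. \<forall>r\<in>insert t (range \<tau>). j (Xn n r \<omega>) =
            S r (y n) + (LINT s:{0..r}|lborel. S (r - s) (j (f (Xn n s \<omega>)))) + j (WA r \<omega>)"
          using eventually_ge_at_top[of n0]
          by eventually_elim (use elim(2) in \<open>simp only: F, blast\<close>)
        show "(\<lambda>n. j (Xn n r \<omega>)) \<longlonglongrightarrow> j (X r \<omega>)" if "r \<in> insert t (range \<tau>)" for r
          using elim(4) by (rule tendsto_uniform_limitI) (use that \<tau> t in \<open>auto intro: less_imp_le\<close>)
        show "uniform_limit {\<tau> k..t} (\<lambda>n s. j (f (Xn n s \<omega>))) (\<lambda>s. j (f (X s \<omega>))) sequentially" for k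
        proof (rule bounded_linear.uniform_limit[OF bl_j], rule uniform_limit_Lipschitz_on_bounded[OF f])
          show "uniform_limit {\<tau> k..t} (\<lambda>n s. Xn n s \<omega>) (\<lambda>s. X s \<omega>) sequentially" using elim(3) by blast
          show "norm (X s \<omega>) \<le> K" if "s \<in> {\<tau> k..t}" for s using K that \<tau>(1)[of k] by simp
        qed
        show "(\<lambda>k. j (X (\<tau> k) \<omega>)) \<longlonglongrightarrow> j (X 0 \<omega>)"
          by (rule continuous_on_tendsto_compose[OF elim(6) \<tau>0])
            (use \<tau> t in \<open>auto intro: always_eventually less_imp_le\<close>)
        have "(\<lambda>k. WA (\<tau> k) \<omega>) \<longlonglongrightarrow> WA 0 \<omega>"
          by (rule continuous_on_tendsto_compose[OF elim(8) \<tau>0])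
            (use \<tau> in \<open>auto intro: always_eventually less_imp_le\<close>)
        then show "(\<lambda>k. j (WA (\<tau> k) \<omega>)) \<longlonglongrightarrow> j (WA 0 \<omega>)" by (rule j.tendsto)
      qed (use B in auto)
      \<comment> \<open>\<open>mild_limit\<close> yields the initial datum as this difference, which
        \<open>X0\<close> evaluates.\<close>
      moreover have "j (X 0 \<omega>) - j (WA 0 \<omega>) = j x" using elim(9) by (simp add: j.add)
      moreover have "set_integrable lborel {0..t} (\<lambda>s. S (t - s) (j (f (X s \<omega>))))"
        by (rule C0_convolution_integrable[OF C0 B order_refl])
      ultimately show ?case by (simp add: F)
    qed
  qed
  have mild: "mild_equation P Fil j S F WA {0..} (j x) X"
    unfolding mild_equation_def adapted_on_def using X_adapted mild_at by auto
  \<comment> \<open>The unit ball is enough here, since the perturbation lemma tests only vectors of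
    norm one against 0.\<close>
  obtain L where "L-lipschitz_on (cball 0 1) f" using f[OF bounded_cball] by blast
  then have qd: "quasi_dissipative (L + \<bar>\<zeta>\<bar>) domE genE"
    using dissipative_Lipschitz_perturbation[OF sectorial_linear_operator[OF hyp_ii(3)] hyp_iii(2)[folded f_def]]
    unfolding quasi_dissipative_def by blast
  \<comment> \<open>The exceptional set is independent of \<open>t\<close>, so this is
    indistinguishability, which implies the required version property.\<close>
  have unique: "AE \<omega> in P. \<forall>t\<in>{0..T}. Y t \<omega> = X t \<omega>"
    if p: "1 \<le> p" and T: "0 < T" and Y: "mild_equation P Fil j S F WA {0..T} (j x) Y"
      and CY: "Cp_process P Fil p {0..T} (\<lambda>t \<omega>. j (Y t \<omega>))" "Cp_process P Fil p {0<..T} Y" for p T Y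
  proof -
    have 1: "AE \<omega> in P. \<forall>t\<in>\<rat> \<inter> {0<..<T}.
      j (Y t \<omega>) - (LINT s:{0..t}|lborel. S (t - s) (F (j (Y s \<omega>)))) = j (X t \<omega>) - (LINT s:{0..t}|lborel. S (t - s) (F (j (X s \<omega>))))"
    proof (rule AE_ball_countable')
      fix t assume "t \<in> \<rat> \<inter> {0<..<T}"
      then have t: "0 \<le> t" "t \<in> {0..T}" by auto
      have "AE \<omega> in P. set_integrable lborel {0..t} (\<lambda>s. S (t - s) (F (j (Y s \<omega>)))) \<and>
        j (Y t \<omega>) = S t (j x) + (LINT s:{0..t}|lborel. S (t - s) (F (j (Y s \<omega>)))) + j (WA t \<omega>)"
        using Y t(2) unfolding mild_equation_def by blast
      with mild_at[OF t(1)] show "AE \<omega> in P. j (Y t \<omega>) - (LINT s:{0..t}|lborel. S (t - s) (F (j (Y s \<omega>))))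
          = j (X t \<omega>) - (LINT s:{0..t}|lborel. S (t - s) (F (j (X s \<omega>))))"
        by eventually_elim simp
    qed (intro countable_Int1 countable_rat)
    have 2: "AE \<omega> in P. continuous_on {0<..T} (\<lambda>t. Y t \<omega>)" "AE \<omega> in P. continuous_on {0..T} (\<lambda>t. j (Y t \<omega>))"
      using CY by (simp_all add: Cp_process_def)
    have 3: "AE \<omega> in P. \<exists>K. \<forall>t\<in>{0<..T}. norm (Y t \<omega>) \<le> K"
      by (rule Cp_process_AE_bounded[OF CY(2) p T sub])
    show ?thesis
      using 1 2 3 X_cont[OF T] jX_cont[OF T] X_bounded[OF T]
    proof eventually_elim
      case (elim \<omega>)
      obtain K where K: "\<forall>s\<in>{0<..T}. norm (Y s \<omega>) \<le> K" using elim(4) by (elim exE)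
      obtain K' where K': "\<forall>s\<in>{0<..T}. norm (X s \<omega>) \<le> K'" using elim(7) by (elim exE)
      show ?case
      proof
        fix t assume t: "t \<in> {0..T}"
        show "Y t \<omega> = X t \<omega>"
          by (rule mild_paths_eq[OF qd T f elim(2) bspec[OF K] elim(3) elim(5) bspec[OF K'] elim(6)
                bspec[OF elim(1), unfolded F] t])
      qed
    qed
  qed
  show ?thesis
  proof (intro conjI allI impI ballI mild)
    fix p T :: real assume pT: "1 \<le> p" "0 < T"
    then show "Cp_process P Fil p {0..T} (\<lambda>t \<omega>. j (X t \<omega>))" "Cp_process P Fil p {0<..T} X"
      using X_limit(1,2) by auto
    fix Y t assume "mild_equation P Fil j S F WA {0..T} (j x) Y \<and>
        Cp_process P Fil p {0..T} (\<lambda>t \<omega>. j (Y t \<omega>)) \<and> Cp_process P Fil p {0<..T} Y" and t: "t \<in> {0..T}"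
    then have "AE \<omega> in P. \<forall>t\<in>{0..T}. Y t \<omega> = X t \<omega>" using unique pT by blast
    then show "AE \<omega> in P. Y t \<omega> = X t \<omega>" by eventually_elim (use t in blast)
  qed
qed

end
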